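(* For any $1\le\alpha\le1+\frac1n$ and $0<\epsilon\le1/4$, there exists an $n$-qubit state $\rho$ of rank $r$ and the corresponding state $\rho_{\mathtt U}$ such that deciding whether $\mathrm{T}_\alpha(\rho,\rho_{\mathtt U})$ is at least $\epsilon$ or exactly $0$ requires $\Omega\big(r/\epsilon^2\big)$ samples of $\rho$.
   Context: $\mathrm{T}_\alpha(\rho_0,\rho_1)=\frac12\big(\mathrm{tr}(|\rho_0-\rho_1|^\alpha)\big)^{1/\alpha}$, with $|A|=(A^\dagger A)^{1/2}$. For any $n$-qubit quantum state $\rho$ of rank $r$, $\rho_{\mathtt U}$ is the corresponding $n$-qubit quantum state whose eigenvalues are uniformly distributed over the support of $\rho$, i.e. $\rho_{\mathtt U}=\Pi/r$ where $\Pi$ is the orthogonal projector onto the support of $\rho$. Samples are independent identical copies of the unknown state, and the complexity is the number of copies used by a bounded-error quantum algorithm for the decision task.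
   Formalization: The rank r is taken to be at least 2: a state of rank 1 always equals its own uniform state, so for r = 1 the decision task is void, needs no samples, and the stated lower bound fails. *)

theory Defs
  imports
    "Jordan_Normal_Form.Schur_Decomposition"
    "Jordan_Normal_Form.Matrix_Kernel"
    "Jordan_Normal_Form.DL_Rank"
begin

section \<open>Linear algebra\<close>

definition mtrace :: "complex mat \<Rightarrow> complex" where
  "mtrace A = (\<Sum>i<dim_row A. A $$ (i, i))"

definition is_unitary :: "nat \<Rightarrow> complex mat \<Rightarrow> bool" where
  "is_unitary d U \<longleftrightarrow>
     U \<in> carrier_mat d d \<and> U * mat_adjoint U = 1\<^sub>m d \<and> mat_adjoint U * U = 1\<^sub>m d"

definition pos_semidef :: "nat \<Rightarrow> complex mat \<Rightarrow> bool" where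
  "pos_semidef d A \<longleftrightarrow>
     A \<in> carrier_mat d d \<and> mat_adjoint A = A \<and>
     (\<forall>v \<in> carrier_vec d. 0 \<le> Re ((A *\<^sub>v v) \<bullet>c v))"

text \<open>
  Spectral functional calculus for a positive semidefinite matrix: if \<open>A = U diag(x) U\<^sup>\<dagger>\<close> with
  \<open>U\<close> unitary and \<open>x \<ge> 0\<close>, then \<open>A\<^sup>a = U diag(x\<^sup>a) U\<^sup>\<dagger>\<close>; the choice of the
  diagonalisation is irrelevant by \<open>psd_powr_eqI\<close> below. Since \<open>0 powr a = 0\<close> for every \<open>a\<close>,
  the kernel of \<open>A\<close> is kept.
\<close>

definition psd_powr :: "complex mat \<Rightarrow> real \<Rightarrow> complex mat" where
  "psd_powr A a =
     (THE B. \<exists>U x. is_unitary (dim_row A) U \<and> (\<forall>i < dim_row A. 0 \<le> x i) \<and>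
        A = U * mat_diag (dim_row A) (\<lambda>i. complex_of_real (x i)) * mat_adjoint U \<and>
        B = U * mat_diag (dim_row A) (\<lambda>i. complex_of_real (x i powr a)) * mat_adjoint U)"

definition mat_abs :: "complex mat \<Rightarrow> complex mat" where
  "mat_abs A = psd_powr (mat_adjoint A * A) (1/2)"

definition T_dist :: "real \<Rightarrow> complex mat \<Rightarrow> complex mat \<Rightarrow> real" where
  "T_dist \<alpha> \<rho>\<^sub>0 \<rho>\<^sub>1 =
     1/2 * (Re (mtrace (psd_powr (mat_abs (\<rho>\<^sub>0 - \<rho>\<^sub>1)) \<alpha>))) powr (1/\<alpha>)"

definition kron :: "complex mat \<Rightarrow> complex mat \<Rightarrow> complex mat" where
  "kron A B = mat (dim_row A * dim_row B) (dim_col A * dim_col B)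
     (\<lambda>(i, j). A $$ (i div dim_row B, j div dim_col B) * B $$ (i mod dim_row B, j mod dim_col B))"

primrec tensor_pow :: "complex mat \<Rightarrow> nat \<Rightarrow> complex mat" where
  "tensor_pow A 0 = 1\<^sub>m 1"
| "tensor_pow A (Suc m) = kron A (tensor_pow A m)"

section \<open>States\<close>

definition qubit_state :: "nat \<Rightarrow> complex mat \<Rightarrow> bool" where
  "qubit_state n \<rho> \<longleftrightarrow> pos_semidef (2 ^ n) \<rho> \<and> mtrace \<rho> = 1"

definition mrank :: "complex mat \<Rightarrow> nat" where
  "mrank A = vec_space.rank (dim_row A) A"

text \<open>The support of a Hermitian matrix is the orthogonal complement of its kernel.\<close>

definition support :: "complex mat \<Rightarrow> complex vec set" where
  "support A = {v \<in> carrier_vec (dim_row A). \<forall>w \<in> mat_kernel A. v \<bullet>c w = 0}"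

definition support_proj :: "complex mat \<Rightarrow> complex mat" where
  "support_proj A =
     (THE P. P \<in> carrier_mat (dim_row A) (dim_row A) \<and> mat_adjoint P = P \<and> P * P = P \<and>
        (\<lambda>v. P *\<^sub>v v) ` carrier_vec (dim_row A) = support A)"

definition uniform_state :: "complex mat \<Rightarrow> complex mat" where
  "uniform_state \<rho> = (1 / of_nat (mrank \<rho>)) \<cdot>\<^sub>m support_proj \<rho>"

section \<open>Algorithms using copies of an unknown state\<close>

text \<open>
  Whatever circuit, ancillas and intermediate measurements a quantum algorithm uses, the law of its
  one-bit output on \<open>m\<close> copies of \<open>\<rho>\<close> is that of a two-outcome measurement
  \<open>{M False, M True}\<close> (a POVM, collective over all copies) of \<open>\<rho>\<^sup>\<otimes>\<^sup>m\<close>, and every such POVM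
  arises in this way. The POVM may depend on the known parameters of the task, but not on \<open>\<rho>\<close>.
\<close>

definition binary_measurement :: "nat \<Rightarrow> (bool \<Rightarrow> complex mat) \<Rightarrow> bool" where
  "binary_measurement D M \<longleftrightarrow> (\<forall>b. pos_semidef D (M b)) \<and> M False + M True = 1\<^sub>m D"

definition output_prob :: "(bool \<Rightarrow> complex mat) \<Rightarrow> nat \<Rightarrow> complex mat \<Rightarrow> bool \<Rightarrow> real" where
  "output_prob M m \<rho> b = Re (mtrace (M b * tensor_pow \<rho> m))"

text \<open>
  \<open>M\<close> decides, from \<open>m\<close> copies of an unknown \<open>n\<close>-qubit state \<open>\<rho>\<close> of rank \<open>r\<close>, between
  \<open>T\<^sub>\<alpha>(\<rho>, \<rho>\<^sub>U) \<ge> \<epsilon>\<close> (output \<open>True\<close>) and \<open>T\<^sub>\<alpha>(\<rho>, \<rho>\<^sub>U) = 0\<close> (output \<open>False\<close>), with error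
  probability at most \<open>1/3\<close>.
\<close>

definition decides_uniformity ::
    "nat \<Rightarrow> nat \<Rightarrow> real \<Rightarrow> real \<Rightarrow> nat \<Rightarrow> (bool \<Rightarrow> complex mat) \<Rightarrow> bool" where
  "decides_uniformity n r \<alpha> \<epsilon> m M \<longleftrightarrow>
     binary_measurement ((2 ^ n) ^ m) M \<and>
     (\<forall>\<rho>. qubit_state n \<rho> \<and> mrank \<rho> = r \<longrightarrow>
        (T_dist \<alpha> \<rho> (uniform_state \<rho>) \<ge> \<epsilon> \<longrightarrow> output_prob M m \<rho> True \<ge> 2/3) \<and>
        (T_dist \<alpha> \<rho> (uniform_state \<rho>) = 0 \<longrightarrow> output_prob M m \<rho> False \<ge> 2/3))"

section \<open>Well-definedness\<close>

lemma adjoint_index: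
  assumes "A \<in> carrier_mat d d" "i < d" "j < d"
  shows "mat_adjoint A $$ (i, j) = cnj (A $$ (j, i))"
  using assms by (simp add: mat_adjoint_def mat_of_rows_def)

lemma adjoint_carrier: "A \<in> carrier_mat d d \<Longrightarrow> mat_adjoint A \<in> carrier_mat d d"
  by (auto simp: mat_adjoint_def)

lemma psd_powr_unique:
  fixes x y :: "nat \<Rightarrow> real"
  assumes U: "is_unitary d U" and V: "is_unitary d V"
    and x: "\<forall>i<d. 0 \<le> x i" and y: "\<forall>i<d. 0 \<le> y i"
    and eq: "U * mat_diag d (\<lambda>i. complex_of_real (x i)) * mat_adjoint U =
             V * mat_diag d (\<lambda>i. complex_of_real (y i)) * mat_adjoint V"
  shows "U * mat_diag d (\<lambda>i. complex_of_real (x i powr a)) * mat_adjoint U =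
         V * mat_diag d (\<lambda>i. complex_of_real (y i powr a)) * mat_adjoint V"
proof -
  let ?D = "\<lambda>z. mat_diag d (\<lambda>i. complex_of_real (z i))"
  let ?W = "mat_adjoint V * U"
  have c: "U \<in> carrier_mat d d" "V \<in> carrier_mat d d"
    "mat_adjoint U \<in> carrier_mat d d" "mat_adjoint V \<in> carrier_mat d d"
    using U V adjoint_carrier unfolding is_unitary_def by auto
  have D: "?D z \<in> carrier_mat d d" for z by simp
  have W: "?W \<in> carrier_mat d d" using c by auto
  note as = assoc_mult_mat[of _ d d _ d _ d] and mc = mult_carrier_mat[of _ d d _ d]
  have conj: "U * ?D z * mat_adjoint U = V * ?D w * mat_adjoint V \<longleftrightarrow> ?W * ?D z = ?D w * ?W"
    for z w
  proof
    assume h: "U * ?D z * mat_adjoint U = V * ?D w * mat_adjoint V"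
    have "mat_adjoint V * (U * ?D z * mat_adjoint U) * U = ?W * ?D z * (mat_adjoint U * U)"
      using c D by (simp add: as mc)
    moreover have "mat_adjoint V * (V * ?D w * mat_adjoint V) * U
        = (mat_adjoint V * V) * ?D w * ?W"
      using c D by (simp add: as mc)
    ultimately show "?W * ?D z = ?D w * ?W"
      using h U V c D W unfolding is_unitary_def
      by (simp add: mc right_mult_one_mat[of _ d d] left_mult_one_mat[of _ d d])
  next
    assume h: "?W * ?D z = ?D w * ?W"
    have "V * (?W * ?D z) * mat_adjoint U = (V * mat_adjoint V) * (U * ?D z * mat_adjoint U)"
      using c D by (simp add: as mc)
    moreover have "V * (?D w * ?W) * mat_adjoint U
        = V * ?D w * mat_adjoint V * (U * mat_adjoint U)"
      using c D by (simp add: as mc)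
    ultimately show "U * ?D z * mat_adjoint U = V * ?D w * mat_adjoint V"
      using h U V c D W unfolding is_unitary_def
      by (simp add: mc right_mult_one_mat[of _ d d] left_mult_one_mat[of _ d d])
  qed
  have ent: "?W * ?D z = ?D w * ?W \<longleftrightarrow>
      (\<forall>i<d. \<forall>j<d. ?W $$ (i, j) * of_real (z j) = of_real (w i) * ?W $$ (i, j))" for z w
    using W unfolding mat_diag_mult_right[OF W] mat_diag_mult_left[OF W]
    by (auto simp: mat_eq_iff)
  from eq have e: "\<forall>i<d. \<forall>j<d. ?W $$ (i, j) * of_real (x j) = of_real (y i) * ?W $$ (i, j)"
    unfolding conj ent .
  have "\<forall>i<d. \<forall>j<d. ?W $$ (i, j) * of_real (x j powr a) = of_real (y i powr a) * ?W $$ (i, j)"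
  proof (intro allI impI)
    fix i j assume "i < d" "j < d"
    with e have "?W $$ (i, j) * (of_real (x j) - of_real (y i)) = 0"
      by (simp add: algebra_simps)
    hence "?W $$ (i, j) = 0 \<or> x j = y i" by simp
    thus "?W $$ (i, j) * of_real (x j powr a) = of_real (y i powr a) * ?W $$ (i, j)" by auto
  qed
  thus ?thesis unfolding conj ent .
qed

lemma psd_powr_eqI:
  fixes x :: "nat \<Rightarrow> real"
  assumes "is_unitary d U" "\<forall>i<d. 0 \<le> x i"
    and "A = U * mat_diag d (\<lambda>i. complex_of_real (x i)) * mat_adjoint U"
  shows "psd_powr A a = U * mat_diag d (\<lambda>i. complex_of_real (x i powr a)) * mat_adjoint U"
proof -
  have d: "dim_row A = d" using assms unfolding is_unitary_def by auto
  show ?thesis unfolding psd_powr_def d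
    by (rule the_equality) (use assms psd_powr_unique in blast)+
qed

lemma support_proj_eqI:
  assumes P: "P \<in> carrier_mat (dim_row A) (dim_row A)" "mat_adjoint P = P" "P * P = P"
    and im: "(\<lambda>v. P *\<^sub>v v) ` carrier_vec (dim_row A) = support A"
  shows "support_proj A = P"
proof -
  let ?d = "dim_row A"
  have key: "Q * R = R" if Q: "Q \<in> carrier_mat ?d ?d" "Q * Q = Q" and R: "R \<in> carrier_mat ?d ?d"
    and i: "(\<lambda>v. Q *\<^sub>v v) ` carrier_vec ?d = support A"
      "(\<lambda>v. R *\<^sub>v v) ` carrier_vec ?d = support A" for Q R :: "complex mat"
  proof -
    have "Q *\<^sub>v (R *\<^sub>v v) = R *\<^sub>v v" if v: "v \<in> carrier_vec ?d" for v
    proof -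
      from v i have "R *\<^sub>v v \<in> (\<lambda>v. Q *\<^sub>v v) ` carrier_vec ?d" by blast
      then obtain w where "w \<in> carrier_vec ?d" "R *\<^sub>v v = Q *\<^sub>v w" by auto
      thus ?thesis using Q by (metis assoc_mult_mat_vec)
    qed
    hence "(Q * R) *\<^sub>v v = R *\<^sub>v v" if "v \<in> carrier_vec ?d" for v
      using that Q R by (metis assoc_mult_mat_vec)
    hence "((Q * R) *\<^sub>v unit_vec ?d j) $ i = (R *\<^sub>v unit_vec ?d j) $ i" for i j by simp
    moreover have "(B *\<^sub>v unit_vec ?d j) $ i = B $$ (i, j)"
      if "B \<in> carrier_mat ?d ?d" "i < ?d" "j < ?d" for B :: "complex mat" and i j
      using that by simp
    ultimately have "(Q * R) $$ (i, j) = R $$ (i, j)" if "i < ?d" "j < ?d" for i j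
      using that Q R by (metis mult_carrier_mat)
    thus ?thesis using Q R by (intro eq_matI) auto
  qed
  have adj: "mat_adjoint (Q * R) = mat_adjoint R * mat_adjoint Q"
    if "Q \<in> carrier_mat ?d ?d" "R \<in> carrier_mat ?d ?d" for Q R :: "complex mat"
  proof -
    have c: "mat_adjoint Q \<in> carrier_mat ?d ?d" "mat_adjoint R \<in> carrier_mat ?d ?d"
      "Q * R \<in> carrier_mat ?d ?d" "mat_adjoint (Q * R) \<in> carrier_mat ?d ?d"
      using that by (auto intro!: adjoint_carrier mult_carrier_mat)
    show ?thesis
    proof (rule eq_matI)
      fix i j assume "i < dim_row (mat_adjoint R * mat_adjoint Q)"
        "j < dim_col (mat_adjoint R * mat_adjoint Q)"
      hence ij: "i < ?d" "j < ?d" using c by auto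
      have "mat_adjoint (Q * R) $$ (i, j) = cnj ((Q * R) $$ (j, i))"
        using adjoint_index[OF c(3) ij] .
      also have "\<dots> = (\<Sum>k<?d. cnj (Q $$ (j, k)) * cnj (R $$ (k, i)))"
        using that ij by (simp add: scalar_prod_def atLeast0LessThan)
      also have "\<dots> = (\<Sum>k<?d. mat_adjoint R $$ (i, k) * mat_adjoint Q $$ (k, j))"
        using that ij by (intro sum.cong) (auto simp: adjoint_index)
      also have "\<dots> = (mat_adjoint R * mat_adjoint Q) $$ (i, j)"
        using c ij by (simp add: scalar_prod_def atLeast0LessThan)
      finally show "mat_adjoint (Q * R) $$ (i, j) = (mat_adjoint R * mat_adjoint Q) $$ (i, j)" .
    qed (use c in auto)
  qed
  have uniq: "P' = P" if P': "P' \<in> carrier_mat ?d ?d" "mat_adjoint P' = P'" "P' * P' = P'"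
      "(\<lambda>v. P' *\<^sub>v v) ` carrier_vec ?d = support A" for P'
  proof -
    have "P * P' = P'" "P' * P = P" using key P P' im by auto
    moreover have "mat_adjoint (P * P') = P' * P" using adj P P' by simp
    ultimately show ?thesis using P'(2) by simp
  qed
  show ?thesis unfolding support_proj_def
    by (rule the_equality) (use P im uniq in blast)+
qed

end

theory Submission
  imports Defs "HOL-Combinatorics.Permutations" "HOL-Analysis.L2_Norm"
begin

text \<open>
  Put \<open>k = \<lfloor>r/2\<rfloor>\<close>. For a permutation \<open>p\<close> of \<open>k\<close> points let \<open>Y\<^sub>p\<close> be the matrix exchanging the basis
  vectors \<open>i\<close> and \<open>k + p i\<close>, and let \<open>\<rho>\<^sub>p = (\<Pi> + \<delta> Y\<^sub>p)/r\<close>, where \<open>\<Pi>\<close> projects onto the first \<open>r\<close>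
  coordinates. Since \<open>Y\<^sub>p\<^sup>2\<close> is a diagonal projector, the distance of \<open>\<rho>\<^sub>p\<close> from \<open>\<sigma> = \<Pi>/r\<close> is explicit, and
  it equals \<open>\<epsilon>\<close> for some \<open>\<delta> < 4\<epsilon>\<close>. An algorithm solving the task tells \<open>\<sigma>\<^sup>\<otimes>\<^sup>m\<close> from the
  average \<open>A\<close> of \<open>\<rho>\<^sub>p\<^sup>\<otimes>\<^sup>m\<close> over all \<open>p\<close>. As \<open>r tr(\<rho>\<^sub>p \<rho>\<^sub>q) = 1 + 2 \<delta>\<^sup>2 F/r\<close> with \<open>F\<close> the number of agreements
  of \<open>p\<close> and \<open>q\<close>, the squared Hilbert--Schmidt norm of \<open>A - \<sigma>\<^sup>\<otimes>\<^sup>m\<close>, multiplied by \<open>r\<^sup>m\<close>, is at most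
  \<open>E(z\<^sup>F) - 1\<close> with \<open>z = exp(2 m \<delta>\<^sup>2/r)\<close>. The number of agreements of two random permutations is
  nearly Poisson with mean \<open>1\<close>, so \<open>E(z\<^sup>F) \<le> exp(z - 1)\<close>, which is close to \<open>1\<close> unless
  \<open>m\<close> is at least of order \<open>r/\<epsilon>\<^sup>2\<close>.
\<close>

section \<open>Perturbations of the uniform state\<close>

definition perturbed :: "nat \<Rightarrow> nat \<Rightarrow> nat \<Rightarrow> (nat \<Rightarrow> nat) \<Rightarrow> real \<Rightarrow> real \<Rightarrow> complex mat" where
  "perturbed d r K \<tau> a b = mat d d (\<lambda>(i, j). complex_of_real
     ((if i < r \<and> i = j then a else 0) + (if i < K \<and> j = \<tau> i then b else 0)))"

lemma perturbed_carrier [simp]: "perturbed d r K \<tau> a b \<in> carrier_mat d d"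
  and perturbed_dim [simp]: "dim_row (perturbed d r K \<tau> a b) = d" "dim_col (perturbed d r K \<tau> a b) = d"
  by (simp_all add: perturbed_def)

lemma perturbed_no_swap: "perturbed d r K \<tau> a 0 = mat_diag d (\<lambda>i. if i < r then complex_of_real a else 0)"
  by (rule eq_matI) (auto simp: perturbed_def mat_diag_def)

lemma perturbed_smult: "complex_of_real c \<cdot>\<^sub>m perturbed d r K \<tau> a b = perturbed d r K \<tau> (c * a) (c * b)"
  by (rule eq_matI) (auto simp: perturbed_def algebra_simps)

lemma perturbed_diff:
  "perturbed d r K \<tau> a b - perturbed d r K \<tau> a 0 = perturbed d r K \<tau> 0 b"
  by (rule eq_matI) (auto simp: perturbed_def)

lemma psd_powr_mat_diag:
  fixes x :: "nat \<Rightarrow> real"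
  assumes "\<forall>i<d. 0 \<le> x i"
  shows "psd_powr (mat_diag d (\<lambda>i. complex_of_real (x i))) a = mat_diag d (\<lambda>i. complex_of_real (x i powr a))"
proof -
  have adj: "mat_adjoint (1\<^sub>m d :: complex mat) = 1\<^sub>m d"
    by (rule eq_matI) (use adjoint_carrier[OF one_carrier_mat] in \<open>auto simp: adjoint_index[OF one_carrier_mat]\<close>)
  hence "is_unitary d (1\<^sub>m d)" by (simp add: is_unitary_def)
  from psd_powr_eqI[OF this assms refl, of a] show ?thesis
    by (simp add: adj left_mult_one_mat[OF mat_diag_dim] right_mult_one_mat[OF mat_diag_dim])
qed

locale pairing =
  fixes d r K :: nat and \<tau> :: "nat \<Rightarrow> nat"
  assumes Kr: "K \<le> r" and rd: "r \<le> d"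
    and lt: "i < K \<Longrightarrow> \<tau> i < K" and inv: "i < K \<Longrightarrow> \<tau> (\<tau> i) = i" and nofix: "i < K \<Longrightarrow> \<tau> i \<noteq> i"
begin

lemma pairing_sym: "i < K \<and> j = \<tau> i \<longleftrightarrow> j < K \<and> i = \<tau> j"
  using lt inv by metis

lemma bij: "bij_betw \<tau> {..<K} {..<K}"
  by (rule bij_betwI[of _ _ _ \<tau>]) (use lt inv in auto)

lemma adjoint_perturbed [simp]: "mat_adjoint (perturbed d r K \<tau> a b) = perturbed d r K \<tau> a b"
proof (rule eq_matI)
  fix i j assume "i < dim_row (perturbed d r K \<tau> a b)" "j < dim_col (perturbed d r K \<tau> a b)"
  hence "i < d" "j < d" by auto
  thus "mat_adjoint (perturbed d r K \<tau> a b) $$ (i, j) = perturbed d r K \<tau> a b $$ (i, j)"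
    by (subst adjoint_index[OF perturbed_carrier]) (use pairing_sym[of i j] in \<open>auto simp: perturbed_def\<close>)
qed (use adjoint_carrier[OF perturbed_carrier[of d r K \<tau> a b]] in auto)

lemma perturbed_mult_vec:
  assumes "v \<in> carrier_vec d" "i < d"
  shows "(perturbed d r K \<tau> a b *\<^sub>v v) $ i =
     (if i < r then of_real a * v $ i else 0) + (if i < K then of_real b * v $ \<tau> i else 0)"
proof -
  have "(perturbed d r K \<tau> a b *\<^sub>v v) $ i = (\<Sum>j<d. complex_of_real
     ((if i < r \<and> i = j then a else 0) + (if i < K \<and> j = \<tau> i then b else 0)) * v $ j)"
    using assms by (simp add: perturbed_def scalar_prod_def atLeast0LessThan)
  also have "\<dots> = (\<Sum>j<d. if j = i then (if i < r then of_real a * v $ i else 0) else 0)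
     + (\<Sum>j<d. if j = \<tau> i then (if i < K then of_real b * v $ \<tau> i else 0) else 0)"
    unfolding sum.distrib[symmetric] by (intro sum.cong) (auto simp: algebra_simps)
  also have "\<dots> = (if i < r then of_real a * v $ i else 0) + (if i < K then of_real b * v $ \<tau> i else 0)"
    using assms lt[of i] Kr rd by (auto simp: sum.delta)
  finally show ?thesis .
qed

lemma mtrace_perturbed:
  fixes a b :: real
  shows "mtrace (perturbed d r K \<tau> a b) = of_real (r * a)"
proof -
  have "mtrace (perturbed d r K \<tau> a b) = (\<Sum>i<d. if i < r then of_real a else 0)"
    unfolding mtrace_def by (intro sum.cong) (auto simp: perturbed_def dest: nofix)
  also have "\<dots> = (\<Sum>i<r. of_real a)"
    using rd by (intro sum.mono_neutral_cong_right) auto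
  finally show ?thesis by simp
qed

lemma pos_semidef_perturbed:
  assumes "0 \<le> b" "b \<le> a"
  shows "pos_semidef d (perturbed d r K \<tau> a b)"
  unfolding pos_semidef_def
proof (intro conjI ballI)
  fix v :: "complex vec" assume v: "v \<in> carrier_vec d"
  let ?n = "\<lambda>i. (cmod (v $ i))\<^sup>2"
  have "Re ((perturbed d r K \<tau> a b *\<^sub>v v) \<bullet>c v)
      = (\<Sum>i<d. Re ((perturbed d r K \<tau> a b *\<^sub>v v) $ i * cnj (v $ i)))"
    using v by (simp add: scalar_prod_def atLeast0LessThan)
  also have "\<dots> = (\<Sum>i<d. (if i < r then a * ?n i else 0) +
       (if i < K then b * Re (v $ \<tau> i * cnj (v $ i)) else 0))"
    by (intro sum.cong refl, subst perturbed_mult_vec[OF v])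
      (simp_all only: cmod_power2, auto simp: algebra_simps power2_eq_square)
  also have "\<dots> = (\<Sum>i<r. a * ?n i) + (\<Sum>i<K. b * Re (v $ \<tau> i * cnj (v $ i)))"
    unfolding sum.distrib using Kr rd
    by (intro arg_cong2[of _ _ _ _ "(+)"] sum.mono_neutral_cong_right) auto
  finally have eq: "Re ((perturbed d r K \<tau> a b *\<^sub>v v) \<bullet>c v)
      = (\<Sum>i<r. a * ?n i) + (\<Sum>i<K. b * Re (v $ \<tau> i * cnj (v $ i)))" .
  have "- Re (v $ \<tau> i * cnj (v $ i)) \<le> (?n i + ?n (\<tau> i)) / 2" for i
  proof -
    have "- Re (v $ \<tau> i * cnj (v $ i)) \<le> cmod (v $ \<tau> i) * cmod (v $ i)"
      using abs_Re_le_cmod[of "v $ \<tau> i * cnj (v $ i)"] by (simp add: norm_mult)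
    also have "\<dots> \<le> (?n i + ?n (\<tau> i)) / 2"
      using sum_squares_bound[of "cmod (v $ \<tau> i)" "cmod (v $ i)"] by simp
    finally show ?thesis .
  qed
  hence "b * - Re (v $ \<tau> i * cnj (v $ i)) \<le> b * ((?n i + ?n (\<tau> i)) / 2)" for i
    using assms by (intro mult_left_mono)
  hence "(\<Sum>i<K. b * - Re (v $ \<tau> i * cnj (v $ i))) \<le> (\<Sum>i<K. b * ((?n i + ?n (\<tau> i)) / 2))"
    by (intro sum_mono)
  also have "\<dots> = b / 2 * ((\<Sum>i<K. ?n i) + (\<Sum>i<K. ?n (\<tau> i)))"
    by (simp add: sum_distrib_left sum.distrib algebra_simps add_divide_distrib)
  also have "(\<Sum>i<K. ?n (\<tau> i)) = (\<Sum>i<K. ?n i)"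
    by (rule sum.reindex_bij_betw[OF bij])
  also have "b / 2 * ((\<Sum>i<K. ?n i) + (\<Sum>i<K. ?n i)) = b * (\<Sum>i<K. ?n i)" by simp
  also have "\<dots> \<le> a * (\<Sum>i<r. ?n i)"
    using assms Kr by (intro mult_mono sum_mono2 sum_nonneg) auto
  finally show "0 \<le> Re ((perturbed d r K \<tau> a b *\<^sub>v v) \<bullet>c v)"
    unfolding eq by (simp only: sum_distrib_left mult_minus_right sum_negf)
qed auto

lemma perturbed_kernel:
  assumes "0 \<le> b" "b < a"
  shows "mat_kernel (perturbed d r K \<tau> a b) = {v \<in> carrier_vec d. \<forall>i<r. v $ i = 0}"
proof (intro equalityI subsetI)
  fix v assume "v \<in> mat_kernel (perturbed d r K \<tau> a b)"
  hence v: "v \<in> carrier_vec d" and 0: "perturbed d r K \<tau> a b *\<^sub>v v = 0\<^sub>v d"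
    by (auto simp: mat_kernel_def)
  have eq: "of_real a * v $ i + (if i < K then of_real b * v $ \<tau> i else 0) = 0" if "i < r" for i
    using that rd arg_cong[OF 0, of "\<lambda>w. w $ i"] by (simp add: perturbed_mult_vec[OF v] del: index_mult_mat_vec)
  have "v $ i = 0" if i: "i < r" for i
  proof (cases "i < K")
    case True
    have "of_real a * v $ i = - (of_real b * v $ \<tau> i)"
      using eq[OF i] True by (simp add: eq_neg_iff_add_eq_0)
    hence 1: "a * cmod (v $ i) = b * cmod (v $ \<tau> i)"
      using assms by (metis abs_of_nonneg norm_minus_cancel norm_mult norm_of_real less_imp_le order_trans)
    have "of_real a * v $ \<tau> i = - (of_real b * v $ i)"
      using eq[of "\<tau> i"] True Kr lt[of i] inv[of i] by (simp add: eq_neg_iff_add_eq_0)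
    hence 2: "a * cmod (v $ \<tau> i) = b * cmod (v $ i)"
      using assms by (metis abs_of_nonneg norm_minus_cancel norm_mult norm_of_real less_imp_le order_trans)
    have "(a - b) * (cmod (v $ i) + cmod (v $ \<tau> i)) = 0"
      using 1 2 by (simp add: algebra_simps)
    hence "cmod (v $ i) + cmod (v $ \<tau> i) = 0" using assms by simp
    thus ?thesis by (smt (verit) norm_ge_zero norm_eq_zero)
  qed (use eq[OF i] assms in auto)
  thus "v \<in> {v \<in> carrier_vec d. \<forall>i<r. v $ i = 0}" using v by simp
next
  fix v :: "complex vec" assume v: "v \<in> {v \<in> carrier_vec d. \<forall>i<r. v $ i = 0}"
  hence "perturbed d r K \<tau> a b *\<^sub>v v = 0\<^sub>v d"
    using less_le_trans[OF lt Kr] by (intro eq_vecI) (auto simp: perturbed_mult_vec simp del: index_mult_mat_vec)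
  thus "v \<in> mat_kernel (perturbed d r K \<tau> a b)"
    using v by (auto simp: mat_kernel_def)
qed

lemma perturbed_support:
  assumes "0 \<le> b" "b < a"
  shows "support (perturbed d r K \<tau> a b) = {v \<in> carrier_vec d. \<forall>i<d. r \<le> i \<longrightarrow> v $ i = 0}"
  unfolding support_def perturbed_kernel[OF assms] perturbed_dim
proof (intro Collect_cong conj_cong refl)
  fix v :: "complex vec" assume v: "v \<in> carrier_vec d"
  show "(\<forall>w\<in>{w \<in> carrier_vec d. \<forall>i<r. w $ i = 0}. v \<bullet>c w = 0) \<longleftrightarrow> (\<forall>i<d. r \<le> i \<longrightarrow> v $ i = 0)"
  proof (intro iffI allI impI ballI)
    fix i assume *: "\<forall>w\<in>{w \<in> carrier_vec d. \<forall>i<r. w $ i = 0}. v \<bullet>c w = 0" and i: "i < d" "r \<le> i"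
    have "v \<bullet>c unit_vec d i = 0" using i by (intro *[rule_format]) auto
    moreover have "v \<bullet>c unit_vec d i = (\<Sum>j<d. if j = i then v $ i else 0)"
      using i by (simp add: scalar_prod_def atLeast0LessThan unit_vec_def if_distrib cong: if_cong)
    ultimately show "v $ i = 0" using i by simp
  next
    fix w :: "complex vec" assume *: "\<forall>i<d. r \<le> i \<longrightarrow> v $ i = 0" and w: "w \<in> {w \<in> carrier_vec d. \<forall>i<r. w $ i = 0}"
    have "v $ i = 0 \<or> w $ i = 0" if "i < d" for i
      using * w that by (cases "i < r") auto
    thus "v \<bullet>c w = 0" using w by (auto simp: scalar_prod_def intro!: sum.neutral)
  qed
qed

lemma perturbed_support_proj:
  assumes "0 \<le> b" "b < a"
  shows "support_proj (perturbed d r K \<tau> a b) = perturbed d r K \<tau> 1 0"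
proof (rule support_proj_eqI)
  show "(\<lambda>v. perturbed d r K \<tau> 1 0 *\<^sub>v v) ` carrier_vec (dim_row (perturbed d r K \<tau> a b))
      = support (perturbed d r K \<tau> a b)"
    unfolding perturbed_support[OF assms] perturbed_dim
  proof (intro equalityI subsetI)
    fix v :: "complex vec" assume v: "v \<in> {v \<in> carrier_vec d. \<forall>i<d. r \<le> i \<longrightarrow> v $ i = 0}"
    hence "v = perturbed d r K \<tau> 1 0 *\<^sub>v v"
      by (intro eq_vecI) (auto simp: perturbed_mult_vec simp del: index_mult_mat_vec)
    thus "v \<in> (\<lambda>v. perturbed d r K \<tau> 1 0 *\<^sub>v v) ` carrier_vec d" using v by blast
  qed (auto simp: perturbed_mult_vec intro!: mult_mat_vec_carrier[of _ d d] simp del: index_mult_mat_vec)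
qed (simp_all, auto simp: perturbed_no_swap intro!: arg_cong[of _ _ "mat_diag d"])

end

lemma mrank_perturbed:
  assumes "pairing d r K \<tau>" "0 \<le> b" "b < a"
  shows "mrank (perturbed d r K \<tau> a b) = r"
proof -
  interpret pairing d r K \<tau> by fact
  interpret full: pairing d d K \<tau> using Kr rd lt inv nofix by unfold_locales auto
  interpret vec_space "TYPE(complex)" d .
  let ?A = "perturbed d r K \<tau> a b" and ?F = "perturbed d d K \<tau> a b"
  have "det ?F \<noteq> 0"
  proof
    assume "det ?F = 0"
    then obtain v where v: "v \<in> carrier_vec d" "v \<noteq> 0\<^sub>v d" "?F *\<^sub>v v = 0\<^sub>v d"
      using det_0_iff_vec_prod_zero_field[of ?F d] by auto
    hence "v \<in> mat_kernel ?F" by (simp add: mat_kernel_def)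
    hence "v = 0\<^sub>v d" unfolding full.perturbed_kernel[OF assms(2,3)] by (intro eq_vecI) auto
    with v show False by blast
  qed
  hence "rank ?F = d" by (rule low_rank_det_zero[rotated]) simp
  hence dist: "distinct (cols ?F)" using non_distinct_low_rank[of ?F] by fastforce
  hence ind: "lin_indpt (set (cols ?F))" using full_rank_lin_indpt[of ?F d] \<open>rank ?F = d\<close> by simp
  let ?S = "col ?A ` {..<r}"
  have cF: "col ?A i = col ?F i" if "i < r" for i
    using that rd by (intro eq_vecI) (auto simp: perturbed_def)
  have c0: "col ?A i = 0\<^sub>v d" if "r \<le> i" "i < d" for i
    using that pairing_sym[of _ i] Kr by (intro eq_vecI) (auto simp: perturbed_def)
  have colsF: "set (cols ?F) = col ?F ` {..<d}" and colsA: "set (cols ?A) = col ?A ` {..<d}"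
    by (auto simp: cols_def)
  have sub: "?S \<subseteq> set (cols ?F)" using cF rd unfolding colsF by fastforce
  have indS: "lin_indpt ?S" using ind sub supset_ld_is_ld by blast
  have "maximal ?S (\<lambda>T. T \<subseteq> set (cols ?A) \<and> lin_indpt T)"
    unfolding maximal_def
  proof (intro conjI allI impI)
    show "?S \<subseteq> set (cols ?A)" unfolding colsA using rd by auto
    fix T assume T: "?S \<subseteq> T \<and> T \<subseteq> set (cols ?A) \<and> lin_indpt T"
    have "(UNIV :: complex set) \<noteq> {0}" by (metis UNIV_I one_neq_zero singletonD)
    moreover have "T \<subseteq> carrier_vec d" using T cols_dim[of ?A] by auto
    ultimately have "0\<^sub>v d \<notin> T"
      using zero_nin_lin_indpt[of T] T by auto
    hence "T \<subseteq> ?S" using T c0 unfolding colsA by (smt (verit) image_iff lessThan_iff linorder_not_le subset_iff)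
    thus "T = ?S" using T by blast
  qed (rule indS)
  hence "rank ?A = card ?S" by (rule rank_card_indpt[OF perturbed_carrier])
  also have "inj_on (col ?A) {..<r}"
    using dist cF less_le_trans[OF _ rd] by (auto simp: inj_on_def distinct_conv_nth)
  hence "card ?S = r" by (simp add: card_image)
  finally show ?thesis by (simp add: mrank_def)
qed

context pairing
begin

lemma uniform_state_perturbed:
  assumes "0 \<le> b" "b < a"
  shows "uniform_state (perturbed d r K \<tau> a b) = perturbed d r K \<tau> (1 / r) 0"
  using mrank_perturbed[OF pairing_axioms assms] perturbed_smult[of "1 / r" d r K \<tau> 1 0]
  by (simp add: uniform_state_def perturbed_support_proj[OF assms])

lemma mat_abs_perturbed:
  assumes "0 \<le> b"
  shows "mat_abs (perturbed d r K \<tau> 0 b) = mat_diag d (\<lambda>i. of_real (if i < K then b else 0))"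
proof -
  have "perturbed d r K \<tau> 0 b * perturbed d r K \<tau> 0 b = mat_diag d (\<lambda>i. of_real (if i < K then b\<^sup>2 else 0))"
  proof (rule eq_matI)
    fix i j assume "i < dim_row (mat_diag d (\<lambda>i. complex_of_real (if i < K then b\<^sup>2 else 0)))"
      "j < dim_col (mat_diag d (\<lambda>i. complex_of_real (if i < K then b\<^sup>2 else 0)))"
    hence ij: "i < d" "j < d" by (auto simp: mat_diag_def)
    have "(perturbed d r K \<tau> 0 b * perturbed d r K \<tau> 0 b) $$ (i, j)
        = (perturbed d r K \<tau> 0 b *\<^sub>v col (perturbed d r K \<tau> 0 b) j) $ i"
      using ij by simp
    also have "\<dots> = (if i < K then of_real b * perturbed d r K \<tau> 0 b $$ (\<tau> i, j) else 0)"
      using ij lt[of i] Kr rd by (subst perturbed_mult_vec) (auto simp: col_def)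
    also have "\<dots> = mat_diag d (\<lambda>i. of_real (if i < K then b\<^sup>2 else 0)) $$ (i, j)"
      using ij lt[of i] Kr rd inv[of i] by (auto simp: perturbed_def mat_diag_def power2_eq_square)
    finally show "(perturbed d r K \<tau> 0 b * perturbed d r K \<tau> 0 b) $$ (i, j) =
       mat_diag d (\<lambda>i. of_real (if i < K then b\<^sup>2 else 0)) $$ (i, j)" .
  qed (auto simp: mat_diag_def)
  thus ?thesis
    unfolding mat_abs_def adjoint_perturbed
    using psd_powr_mat_diag[of d "\<lambda>i. if i < K then b\<^sup>2 else 0" "1/2"] assms
    by (auto simp: powr_half_sqrt intro!: arg_cong[of _ _ "mat_diag d"])
qed

lemma T_dist_perturbed:
  assumes "0 \<le> b"
  shows "T_dist \<alpha> (perturbed d r K \<tau> a b) (perturbed d r K \<tau> a 0)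
    = 1 / 2 * (K * b powr \<alpha>) powr (1 / \<alpha>)"
proof -
  have "mtrace (mat_diag d (\<lambda>i. complex_of_real ((if i < K then b else 0) powr \<alpha>)))
      = (\<Sum>i<d. if i < K then of_real (b powr \<alpha>) else 0)"
    unfolding mtrace_def by (intro sum.cong) (auto simp: mat_diag_def)
  also have "\<dots> = (\<Sum>i<K. of_real (b powr \<alpha>))"
    using Kr rd by (intro sum.mono_neutral_cong_right) auto
  finally show ?thesis
    unfolding T_dist_def perturbed_diff mat_abs_perturbed[OF assms]
    by (subst psd_powr_mat_diag) (use assms in auto)
qed

end

section \<open>Agreements of permutations\<close>

lemma permutes_fixing_eq: "{p. p permutes A \<and> (\<forall>i\<in>S. p i = i)} = {p. p permutes (A - S)}" if "S \<subseteq> A"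
  using that by (auto simp: permutes_def)

text \<open>Expand \<open>(1 + x)\<close> to the number of fixed points over the sets of fixed points.\<close>

lemma sum_power_fixpoints:
  fixes x :: real
  assumes "finite A"
  shows "(\<Sum>p | p permutes A. (1 + x) ^ card {i \<in> A. p i = i}) = fact (card A) * (\<Sum>j\<le>card A. x ^ j / fact j)"
proof -
  let ?P = "{p. p permutes A}"
  have fin: "finite ?P" using assms by (rule finite_permutations)
  have "(\<Sum>p\<in>?P. (1 + x) ^ card {i \<in> A. p i = i}) = (\<Sum>p\<in>?P. \<Sum>S | S \<in> Pow A \<and> (\<forall>i\<in>S. p i = i). x ^ card S)"
  proof (intro sum.cong refl)
    fix p
    have "(1 + x) ^ card {i \<in> A. p i = i} = (\<Prod>i\<in>{i \<in> A. p i = i}. x + 1)"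
      by (simp add: add.commute)
    also have "\<dots> = (\<Sum>S\<in>Pow {i \<in> A. p i = i}. x ^ card S)"
      using assms by (subst prod_add) auto
    also have "Pow {i \<in> A. p i = i} = {S. S \<in> Pow A \<and> (\<forall>i\<in>S. p i = i)}" by auto
    finally show "(1 + x) ^ card {i \<in> A. p i = i} = (\<Sum>S | S \<in> Pow A \<and> (\<forall>i\<in>S. p i = i). x ^ card S)" .
  qed
  also have "\<dots> = (\<Sum>S\<in>Pow A. \<Sum>p | p \<in> ?P \<and> (\<forall>i\<in>S. p i = i). x ^ card S)"
    by (rule sum.swap_restrict) (use fin assms in auto)
  also have "\<dots> = (\<Sum>S\<in>Pow A. fact (card A - card S) * x ^ card S)"
  proof (intro sum.cong refl)
    fix S assume "S \<in> Pow A"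
    hence S: "S \<subseteq> A" "finite S" using assms finite_subset by auto
    have "card {p. p \<in> ?P \<and> (\<forall>i\<in>S. p i = i)} = fact (card A - card S)"
      using permutes_fixing_eq[OF S(1)] card_permutations[of "A - S", OF refl] assms S
      by (simp add: card_Diff_subset)
    thus "(\<Sum>p | p \<in> ?P \<and> (\<forall>i\<in>S. p i = i). x ^ card S) = fact (card A - card S) * x ^ card S"
      by simp
  qed
  also have "\<dots> = (\<Sum>j\<le>card A. \<Sum>S\<in>{S \<in> Pow A. card S = j}. fact (card A - card S) * x ^ card S)"
    by (rule sum.group[symmetric]) (use assms in \<open>auto intro: card_mono\<close>)
  also have "\<dots> = (\<Sum>j\<le>card A. real (card A choose j) * (fact (card A - j) * x ^ j))"
  proof (intro sum.cong refl)
    fix j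
    have "(\<Sum>S\<in>{S \<in> Pow A. card S = j}. fact (card A - card S) * x ^ card S)
        = (\<Sum>S\<in>{S \<in> Pow A. card S = j}. fact (card A - j) * x ^ j)"
      by (intro sum.cong) auto
    also have "\<dots> = real (card A choose j) * (fact (card A - j) * x ^ j)"
      using n_subsets[OF assms, of j] by simp
    finally show "(\<Sum>S\<in>{S \<in> Pow A. card S = j}. fact (card A - card S) * x ^ card S)
        = real (card A choose j) * (fact (card A - j) * x ^ j)" .
  qed
  also have "\<dots> = fact (card A) * (\<Sum>j\<le>card A. x ^ j / fact j)"
    unfolding sum_distrib_left by (intro sum.cong) (auto simp: binomial_fact)
  finally show ?thesis .
qed

lemma sum_power_fixpoints_le:
  fixes z :: real
  assumes "finite A" "1 \<le> z"
  shows "(\<Sum>p | p permutes A. z ^ card {i \<in> A. p i = i}) \<le> fact (card A) * exp (z - 1)"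
proof -
  have "(\<Sum>j\<le>card A. (z - 1) ^ j / fact j) \<le> (\<Sum>j. (z - 1) ^ j / fact j)"
    using assms summable_exp[of "z - 1"]
    by (intro sum_le_suminf) (auto simp: field_simps)
  also have "\<dots> = exp (z - 1)" by (simp add: exp_def field_simps)
  finally show ?thesis
    using sum_power_fixpoints[OF assms(1), of "z - 1"] by simp
qed

lemma sum_power_agreements_le:
  fixes z :: real
  assumes "finite A" "1 \<le> z"
  shows "(\<Sum>p | p permutes A. \<Sum>q | q permutes A. z ^ card {i \<in> A. p i = q i})
    \<le> (fact (card A))\<^sup>2 * exp (z - 1)"
proof -
  have "(\<Sum>q | q permutes A. z ^ card {i \<in> A. p i = q i}) \<le> fact (card A) * exp (z - 1)"
    if p: "p permutes A" for p
  proof -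
    have "(\<Sum>q | q permutes A. z ^ card {i \<in> A. p i = q i})
        = (\<Sum>q | q permutes A. z ^ card {i \<in> A. p i = (p \<circ> q) i})"
      by (rule setum_permutations_compose_left[OF p])
    also have "\<dots> = (\<Sum>q | q permutes A. z ^ card {i \<in> A. q i = i})"
      using inj_eq[OF permutes_inj[OF p]] by (intro sum.cong refl arg_cong[of _ _ "\<lambda>S. z ^ card S"]) auto
    finally show ?thesis using sum_power_fixpoints_le[OF assms] by simp
  qed
  hence "(\<Sum>p | p permutes A. \<Sum>q | q permutes A. z ^ card {i \<in> A. p i = q i})
      \<le> (\<Sum>p | p permutes A. fact (card A) * exp (z - 1))"
    by (intro sum_mono) auto
  also have "\<dots> = (fact (card A))\<^sup>2 * exp (z - 1)"
    using card_permutations[OF refl assms(1)] by (simp add: power2_eq_square)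
  finally show ?thesis .
qed

section \<open>The size of the perturbation\<close>

lemma power_bound_even_part:
  fixes n r :: nat
  assumes "2 \<le> r" "r \<le> 2 ^ n"
  shows "r ^ Suc n < 2 ^ Suc n * (2 * (r div 2)) ^ n"
proof (cases "even r")
  case True
  hence "2 * (r div 2) = r" by simp
  moreover have "r * r ^ n < (2 * 2 ^ n) * r ^ n" using assms by (intro mult_strict_right_mono) auto
  ultimately show ?thesis by simp
next
  case False
  hence odd: "odd r" "3 \<le> r" using assms by (auto elim: oddE)
  have K: "2 * (r div 2) = r - 1" using odd by (simp add: odd_two_times_div_two_nat)
  have "3 \<le> r \<Longrightarrow> r < 2 ^ n \<Longrightarrow> real r ^ Suc n < 2 ^ Suc n * (real r - 1) ^ n" if "n \<ge> 2" for n
    using that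
  proof (induction n rule: dec_induct)
    case base
    hence "r = 3" by auto
    thus ?case by (simp add: power_numeral_reduce)
  next
    case (step n)
    show ?case
    proof (cases "r < 2 ^ n")
      case True
      have "real r ^ Suc (Suc n) < real r * (2 ^ Suc n * (real r - 1) ^ n)"
        using step True by simp
      also have "\<dots> \<le> (2 * (real r - 1)) * (2 ^ Suc n * (real r - 1) ^ n)"
        using step by (intro mult_right_mono) auto
      also have "\<dots> = 2 ^ Suc (Suc n) * (real r - 1) ^ Suc n" by (simp only: power_Suc ac_simps)
      finally show ?thesis .
    next
      case False
      have "2 * n + 2 \<le> 2 ^ n \<or> n = 2"
      proof -
        have "2 * m + 2 \<le> 2 ^ m" if "3 \<le> m" for m :: nat
          using that by (induction m rule: dec_induct) auto
        thus ?thesis using step(1) by (cases "n = 2") auto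
      qed
      thus ?thesis
      proof
        assume n: "n = 2"
        hence "r \<in> {4, 5, 6, 7}" using step False by auto
        thus ?thesis using n by (auto simp: power_numeral_reduce)
      next
        assume n: "2 * n + 2 \<le> 2 ^ n"
        define x :: real where "x = r"
        have x: "x + 1 \<le> 2 ^ Suc n" "2 * n + 3 \<le> x + 1" "3 \<le> x"
        proof -
          have "r + 1 \<le> 2 ^ Suc n" using step by simp
          thus "x + 1 \<le> 2 ^ Suc n" 
            unfolding x_def using of_nat_le_iff[where 'a = real, of "r + 1" "2 ^ Suc n"] by simp
          show "2 * n + 3 \<le> x + 1" using n False by (simp add: x_def)
          show "3 \<le> x" using step by (simp add: x_def)
        qed
        have bern: "1 - Suc n / x \<le> (1 - 1 / x) ^ Suc n"
          using Bernoulli_inequality[of "- 1 / x" "Suc n"] x by (simp add: field_simps)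
        have "x\<^sup>2 < 2 * (x + 1) * (x - Suc n)"
        proof -
          have "2 * real (Suc n) * (x + 1) \<le> x * (x + 1)" using x by (intro mult_right_mono) auto
          thus ?thesis using x by (simp add: power2_eq_square algebra_simps)
        qed
        also have "\<dots> \<le> 2 * 2 ^ Suc n * (x - Suc n)"
          using x by (intro mult_right_mono mult_left_mono) auto
        finally have "x < 2 ^ Suc (Suc n) * (1 - Suc n / x)"
          using x by (simp add: field_simps power2_eq_square)
        also have "\<dots> \<le> 2 ^ Suc (Suc n) * (1 - 1 / x) ^ Suc n"
          by (intro mult_left_mono bern) auto
        finally have "x * x ^ Suc n < 2 ^ Suc (Suc n) * (1 - 1 / x) ^ Suc n * x ^ Suc n"
          using x by (intro mult_strict_right_mono) auto
        also have "\<dots> = 2 ^ Suc (Suc n) * ((1 - 1 / x) * x) ^ Suc n"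
          by (simp only: power_mult_distrib mult.assoc)
        also have "(1 - 1 / x) * x = x - 1" using x by (simp add: field_simps)
        finally show ?thesis unfolding x_def by simp
      qed
    qed
  qed
  moreover have "r \<noteq> 2 ^ n" using odd by (cases n) auto
  moreover have "n \<ge> 2"
  proof (rule ccontr)
    assume "\<not> 2 \<le> n"
    hence "(2::nat) ^ n \<le> 2 ^ 1" by (intro power_increasing) auto
    thus False using assms odd by simp
  qed
  ultimately have "real r ^ Suc n < 2 ^ Suc n * (real r - 1) ^ n" using assms odd by simp
  also have "real r - 1 = real (r - 1)" using odd by simp
  finally have "real (r ^ Suc n) < real (2 ^ Suc n * (r - 1) ^ n)" by simp
  thus ?thesis unfolding K by (simp only: of_nat_less_iff)
qed

text \<open>This is where \<open>\<alpha> \<le> 1 + 1 / n\<close> enters: passing from the trace norm to the Schatten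
  \<open>\<alpha>\<close>-norm costs less than a factor \<open>2\<close>, so that \<open>\<epsilon> = 1/4\<close> is reached without losing rank,
  even if \<open>r\<close> is odd and one eigenvalue has to stay unperturbed.\<close>

lemma rank_lt_twice_root:
  fixes n r :: nat and \<alpha> :: real
  assumes "1 \<le> n" "2 \<le> r" "r \<le> 2 ^ n" "1 \<le> \<alpha>" "\<alpha> \<le> 1 + 1 / n"
  shows "r < 2 * real (2 * (r div 2)) powr (1 / \<alpha>)"
proof -
  define K where "K = real (2 * (r div 2))"
  have K: "1 \<le> K" using assms by (simp add: K_def)
  have "real (r ^ Suc n) < real (2 ^ Suc n * (2 * (r div 2)) ^ n)"
    using power_bound_even_part[OF assms(2,3)] by (simp only: of_nat_less_iff)
  hence "real r ^ Suc n < 2 ^ Suc n * K ^ n" unfolding K_def by simp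
  also have "K ^ n = K powr ((n / (Suc n)) * real (Suc n))" using K by (simp add: powr_realpow)
  also have "\<dots> = (K powr (n / (Suc n))) ^ Suc n"
    using K by (subst powr_powr[symmetric], subst powr_realpow) simp_all
  also have "2 ^ Suc n * \<dots> = (2 * K powr (n / (Suc n))) ^ Suc n" by (simp only: power_mult_distrib)
  finally have "r < 2 * K powr (n / (Suc n))" by (rule power_less_imp_less_base) simp
  also have "\<dots> \<le> 2 * K powr (1 / \<alpha>)"
    using K assms by (intro mult_left_mono powr_mono) (auto simp: field_simps)
  finally show ?thesis unfolding K_def .
qed

section \<open>Tensor powers\<close>

definition hs_prod :: "complex mat \<Rightarrow> complex mat \<Rightarrow> complex" where
  "hs_prod A B = (\<Sum>i<dim_row A. \<Sum>j<dim_col A. A $$ (i, j) * cnj (B $$ (i, j)))"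

lemma hs_prod_carrier:
  "A \<in> carrier_mat d d \<Longrightarrow> hs_prod A B = (\<Sum>i<d. \<Sum>j<d. A $$ (i, j) * cnj (B $$ (i, j)))"
  by (auto simp: hs_prod_def)

lemma sum_lessThan_mult:
  fixes f :: "nat \<Rightarrow> 'a :: comm_monoid_add"
  shows "(\<Sum>I<d * D. f I) = (\<Sum>i<d. \<Sum>k<D. f (i * D + k))"
proof -
  have "(\<Sum>k<D. f (i * D + k)) = sum f {i * D..<i * D + D}" for i
    by (rule sum.reindex_bij_witness[of _ "\<lambda>I. I - i * D" "\<lambda>k. i * D + k"]) auto
  thus ?thesis by (simp add: sum.nat_group)
qed

lemma block_index_less: "i < d \<Longrightarrow> k < D \<Longrightarrow> i * D + k < d * (D :: nat)"
  by (metis add.commute add_less_cancel_left less_le_trans mult_Suc mult_le_mono1 Suc_leI)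

lemma kron_carrier:
  "A \<in> carrier_mat d d \<Longrightarrow> B \<in> carrier_mat D D \<Longrightarrow> kron A B \<in> carrier_mat (d * D) (d * D)"
  by (auto simp: kron_def)

lemma kron_index:
  assumes "A \<in> carrier_mat d d" "B \<in> carrier_mat D D" "i < d" "j < d" "k < D" "l < D"
  shows "kron A B $$ (i * D + k, j * D + l) = A $$ (i, j) * B $$ (k, l)"
  using assms by (simp add: kron_def block_index_less)

lemma hs_prod_kron:
  assumes "A \<in> carrier_mat d d" "B \<in> carrier_mat D D" "A' \<in> carrier_mat d d" "B' \<in> carrier_mat D D"
  shows "hs_prod (kron A B) (kron A' B') = hs_prod A A' * hs_prod B B'"
proof -
  have "hs_prod (kron A B) (kron A' B') = (\<Sum>i<d. \<Sum>k<D. \<Sum>j<d. \<Sum>l<D.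
      (A $$ (i, j) * cnj (A' $$ (i, j))) * (B $$ (k, l) * cnj (B' $$ (k, l))))"
    unfolding hs_prod_carrier[OF kron_carrier[OF assms(1,2)]] sum_lessThan_mult
    by (intro sum.cong refl) (simp add: kron_index[OF assms(1,2)] kron_index[OF assms(3,4)])
  also have "\<dots> = hs_prod A A' * hs_prod B B'"
    unfolding hs_prod_carrier[OF assms(1)] hs_prod_carrier[OF assms(2)]
    by (simp only: sum_distrib_left sum_distrib_right sum.swap[of _ "{..<D}" "{..<d}"])
  finally show ?thesis .
qed

lemma tensor_pow_carrier: "A \<in> carrier_mat d d \<Longrightarrow> tensor_pow A m \<in> carrier_mat (d ^ m) (d ^ m)"
  by (induction m) (auto intro: kron_carrier)

lemma mtrace_kron:
  assumes "A \<in> carrier_mat d d" "B \<in> carrier_mat D D"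
  shows "mtrace (kron A B) = mtrace A * mtrace B"
proof -
  have "mtrace (kron A B) = (\<Sum>I<d * D. kron A B $$ (I, I))"
    using kron_carrier[OF assms] by (simp only: mtrace_def carrier_matD)
  also have "\<dots> = (\<Sum>i<d. \<Sum>k<D. A $$ (i, i) * B $$ (k, k))"
    unfolding sum_lessThan_mult by (intro sum.cong refl) (simp add: kron_index[OF assms])
  also have "\<dots> = mtrace A * mtrace B"
    using assms by (simp add: mtrace_def sum_product)
  finally show ?thesis .
qed

lemma mtrace_tensor_pow:
  assumes "A \<in> carrier_mat d d"
  shows "mtrace (tensor_pow A m) = mtrace A ^ m"
proof (induction m)
  case 0
  show ?case by (simp add: mtrace_def)
next
  case (Suc m)
  thus ?case using mtrace_kron[OF assms tensor_pow_carrier[OF assms]] by simp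
qed

lemma hs_prod_tensor_pow:
  assumes "A \<in> carrier_mat d d" "B \<in> carrier_mat d d"
  shows "hs_prod (tensor_pow A m) (tensor_pow B m) = hs_prod A B ^ m"
proof (induction m)
  case 0
  show ?case by (simp add: hs_prod_def)
next
  case (Suc m)
  thus ?case using hs_prod_kron[OF assms(1) tensor_pow_carrier assms(2) tensor_pow_carrier] assms by simp
qed

text \<open>The indices in \<open>{..<d ^ m}\<close> all of whose base-\<open>d\<close> digits are below \<open>r\<close>.\<close>

primrec small_digits :: "nat \<Rightarrow> nat \<Rightarrow> nat \<Rightarrow> nat set" where
  "small_digits d r 0 = {0}"
| "small_digits d r (Suc m) = (\<lambda>(i, k). i * d ^ m + k) ` ({..<r} \<times> small_digits d r m)"

lemma finite_small_digits: "finite (small_digits d r m)"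
  by (induction m) auto

lemma card_small_digits: "card (small_digits d r m) \<le> r ^ m"
proof (induction m)
  case (Suc m)
  have "card (small_digits d r (Suc m)) \<le> card ({..<r} \<times> small_digits d r m)"
    unfolding small_digits.simps by (rule card_image_le) (simp add: finite_small_digits)
  also have "\<dots> \<le> r * r ^ m" using Suc by (simp add: card_cartesian_product)
  finally show ?case by simp
qed auto

lemma small_digits_less: "r \<le> d \<Longrightarrow> I \<in> small_digits d r m \<Longrightarrow> I < d ^ m"
  by (induction m arbitrary: I) (auto intro!: block_index_less)

lemma tensor_pow_zero:
  assumes A: "A \<in> carrier_mat d d"
    and 0: "\<And>i j. i < d \<Longrightarrow> j < d \<Longrightarrow> r \<le> i \<or> r \<le> j \<Longrightarrow> A $$ (i, j) = 0"
    and "I < d ^ m" "J < d ^ m" "I \<notin> small_digits d r m \<or> J \<notin> small_digits d r m"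
  shows "tensor_pow A m $$ (I, J) = 0"
  using assms(3-5)
proof (induction m arbitrary: I J)
  case (Suc m)
  let ?D = "d ^ m"
  have D: "0 < ?D" using Suc.prems(1) by (cases "d = 0") auto
  obtain i k j l where ik: "I = i * ?D + k" "k < ?D" "i < d" and jl: "J = j * ?D + l" "l < ?D" "j < d"
    using Suc.prems(1,2) D
    by (metis div_mult_mod_eq less_mult_imp_div_less mod_less_divisor power_Suc)
  have "i \<ge> r \<or> j \<ge> r \<or> k \<notin> small_digits d r m \<or> l \<notin> small_digits d r m"
  proof (rule ccontr)
    assume "\<not> ?thesis"
    hence "I \<in> small_digits d r (Suc m)" "J \<in> small_digits d r (Suc m)"
      unfolding ik jl by (auto intro!: image_eqI[of _ _ "(_, _)"])
    thus False using Suc.prems(3) by blast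
  qed
  thus ?case
    using 0 ik jl Suc.IH by (auto simp: kron_index[OF A tensor_pow_carrier[OF A]])
qed auto

section \<open>Effects and the second moment method\<close>

lemma hermitian_inner_swap:
  fixes M :: "complex mat"
  assumes M: "M \<in> carrier_mat D D" "mat_adjoint M = M" and v: "v \<in> carrier_vec D" "w \<in> carrier_vec D"
  shows "(M *\<^sub>v v) \<bullet>c w = v \<bullet>c (M *\<^sub>v w)"
proof -
  have h: "M $$ (i, j) = cnj (M $$ (j, i))" if "i < D" "j < D" for i j
    using adjoint_index[OF M(1) that] M(2) by simp
  have "(M *\<^sub>v v) \<bullet>c w = (\<Sum>i<D. \<Sum>j<D. M $$ (i, j) * v $ j * cnj (w $ i))"
    using M v by (simp add: scalar_prod_def atLeast0LessThan sum_distrib_right)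
  also have "\<dots> = (\<Sum>j<D. \<Sum>i<D. v $ j * cnj (M $$ (j, i) * w $ i))"
    by (subst sum.swap, intro sum.cong refl, subst h) auto
  also have "\<dots> = v \<bullet>c (M *\<^sub>v w)"
    using M v by (simp add: scalar_prod_def atLeast0LessThan sum_distrib_left)
  finally show ?thesis .
qed

text \<open>With \<open>w = M v\<close>, positivity of \<open>M\<close> on \<open>v - w\<close> and of \<open>1 - M\<close> on \<open>v\<close> and \<open>w\<close> add up to
  \<open>\<parallel>v\<parallel>\<^sup>2 - \<parallel>w\<parallel>\<^sup>2 \<ge> 0\<close>.\<close>

lemma effect_contraction:
  assumes M: "pos_semidef D M" and N: "pos_semidef D N" and sum: "N + M = 1\<^sub>m D"
    and v: "v \<in> carrier_vec D"
  shows "Re ((M *\<^sub>v v) \<bullet>c (M *\<^sub>v v)) \<le> Re (v \<bullet>c v)"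
proof -
  have c: "M \<in> carrier_mat D D" "mat_adjoint M = M" "N \<in> carrier_mat D D"
    using M N unfolding pos_semidef_def by auto
  define w where "w = M *\<^sub>v v"
  have w: "w \<in> carrier_vec D" using c v unfolding w_def by simp
  have le: "Re ((M *\<^sub>v x) \<bullet>c x) \<le> Re (x \<bullet>c x)" if x: "x \<in> carrier_vec D" for x
  proof -
    have "x = N *\<^sub>v x + M *\<^sub>v x"
      using add_mult_distrib_mat_vec[OF c(3,1) x] sum x by simp
    hence "x \<bullet>c x = (N *\<^sub>v x + M *\<^sub>v x) \<bullet>c x" by simp
    also have "\<dots> = (N *\<^sub>v x) \<bullet>c x + (M *\<^sub>v x) \<bullet>c x"
      using c x by (intro add_scalar_prod_distrib[of _ D]) auto
    finally show ?thesis using N x unfolding pos_semidef_def by simp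
  qed
  have Mv: "M *\<^sub>v (v - w) = w - M *\<^sub>v w"
    using mult_minus_distrib_mat_vec[OF c(1) v w] unfolding w_def by simp
  have "(M *\<^sub>v (v - w)) \<bullet>c (v - w) = w \<bullet>c v - w \<bullet>c w - (M *\<^sub>v w) \<bullet>c v + (M *\<^sub>v w) \<bullet>c w"
    unfolding Mv using c v w
    by (simp add: scalar_prod_def algebra_simps sum.distrib sum_subtractf)
  moreover have "(M *\<^sub>v w) \<bullet>c v = w \<bullet>c w"
    using hermitian_inner_swap[OF c(1,2) w v] unfolding w_def by simp
  moreover have "0 \<le> Re ((M *\<^sub>v (v - w)) \<bullet>c (v - w))"
    using M v w unfolding pos_semidef_def by auto
  ultimately show ?thesis using le[OF v] le[OF w] unfolding w_def by simp
qed

lemma effect_column_norm: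
  assumes M: "pos_semidef D M" "pos_semidef D N" "N + M = 1\<^sub>m D" and J: "J < D"
  shows "(\<Sum>I<D. (cmod (M $$ (I, J)))\<^sup>2) \<le> 1"
proof -
  have c: "M \<in> carrier_mat D D" using M unfolding pos_semidef_def by auto
  have "M *\<^sub>v unit_vec D J = col M J"
    using c J by (intro eq_vecI) auto
  hence "Re (col M J \<bullet>c col M J) \<le> Re (unit_vec D J \<bullet>c unit_vec D J)"
    using effect_contraction[OF M unit_vec_carrier[of D J]] by simp
  also have "unit_vec D J \<bullet>c unit_vec D J = (1::complex)"
    using J by (simp add: scalar_prod_def unit_vec_def if_distrib cong: if_cong)
  also have "Re (col M J \<bullet>c col M J) = (\<Sum>I<D. (cmod (M $$ (I, J)))\<^sup>2)"
    using c J by (simp only: cmod_power2) (simp add: scalar_prod_def atLeast0LessThan power2_eq_square)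
  finally show ?thesis by simp
qed

lemma mtrace_mult:
  assumes "A \<in> carrier_mat D D" "B \<in> carrier_mat D D"
  shows "mtrace (A * B) = (\<Sum>I<D. \<Sum>J<D. A $$ (I, J) * B $$ (J, I))"
  using assms by (simp add: mtrace_def scalar_prod_def atLeast0LessThan)

lemma effect_trace_le:
  assumes M: "pos_semidef D M" "pos_semidef D N" "N + M = 1\<^sub>m D"
    and S: "S \<subseteq> {..<D}" and A: "A \<in> carrier_mat D D"
    and 0: "\<And>I J. I < D \<Longrightarrow> J < D \<Longrightarrow> I \<notin> S \<or> J \<notin> S \<Longrightarrow> A $$ (I, J) = 0"
  shows "Re (mtrace (M * A)) \<le> sqrt (card S) * sqrt (Re (hs_prod A A))"
proof -
  have c: "M \<in> carrier_mat D D" using M unfolding pos_semidef_def by auto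
  have fin: "finite S" using S finite_subset by blast
  let ?X = "S \<times> S"
  have "mtrace (M * A) = (\<Sum>(I, J)\<in>?X. M $$ (I, J) * A $$ (J, I))"
    unfolding mtrace_mult[OF c A] sum.cartesian_product
    by (rule sum.mono_neutral_right) (use S 0 in \<open>auto, blast+\<close>)
  also have "Re \<dots> \<le> (\<Sum>(I, J)\<in>?X. cmod (M $$ (I, J)) * cmod (A $$ (J, I)))"
    unfolding Re_sum case_prod_unfold norm_mult[symmetric]
    by (intro sum_mono complex_Re_le_cmod)
  also have "\<dots> \<le> L2_set (\<lambda>(I, J). cmod (M $$ (I, J))) ?X * L2_set (\<lambda>(I, J). cmod (A $$ (J, I))) ?X"
    using L2_set_mult_ineq[of "\<lambda>(I, J). cmod (M $$ (I, J))" "\<lambda>(I, J). cmod (A $$ (J, I))" ?X]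
    by (simp add: case_prod_unfold)
  also have "\<dots> \<le> sqrt (card S) * sqrt (Re (hs_prod A A))"
  proof (intro mult_mono)
    have "(\<Sum>(I, J)\<in>?X. (cmod (M $$ (I, J)))\<^sup>2) = (\<Sum>J\<in>S. \<Sum>I\<in>S. (cmod (M $$ (I, J)))\<^sup>2)"
      by (subst sum.swap) (simp add: sum.cartesian_product)
    also have "\<dots> \<le> (\<Sum>J\<in>S. 1)"
    proof (intro sum_mono)
      fix J assume "J \<in> S"
      have "(\<Sum>I\<in>S. (cmod (M $$ (I, J)))\<^sup>2) \<le> (\<Sum>I<D. (cmod (M $$ (I, J)))\<^sup>2)"
        using S by (intro sum_mono2) auto
      also have "\<dots> \<le> 1" using effect_column_norm[OF M] \<open>J \<in> S\<close> S by auto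
      finally show "(\<Sum>I\<in>S. (cmod (M $$ (I, J)))\<^sup>2) \<le> 1" .
    qed
    finally show "L2_set (\<lambda>(I, J). cmod (M $$ (I, J))) ?X \<le> sqrt (card S)"
      by (simp add: L2_set_def case_prod_unfold)
    have "(\<Sum>(I, J)\<in>?X. (cmod (A $$ (J, I)))\<^sup>2) = (\<Sum>J\<in>S. \<Sum>I\<in>S. (cmod (A $$ (J, I)))\<^sup>2)"
      by (subst sum.swap) (simp add: sum.cartesian_product)
    also have "\<dots> \<le> (\<Sum>J\<in>S. \<Sum>I<D. (cmod (A $$ (J, I)))\<^sup>2)"
      using S by (intro sum_mono sum_mono2) auto
    also have "\<dots> \<le> (\<Sum>J<D. \<Sum>I<D. (cmod (A $$ (J, I)))\<^sup>2)"
      using S by (intro sum_mono2 sum_nonneg) auto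
    also have "\<dots> = Re (hs_prod A A)"
      by (simp only: cmod_power2) (simp add: hs_prod_carrier[OF A] power2_eq_square)
    finally show "L2_set (\<lambda>(I, J). cmod (A $$ (J, I))) ?X \<le> sqrt (Re (hs_prod A A))"
      by (simp add: L2_set_def case_prod_unfold)
  qed (auto simp: L2_set_nonneg)
  finally show ?thesis .
qed

lemma hs_prod_average_diff:
  fixes f :: "'a \<Rightarrow> complex mat"
  assumes P: "finite P" "P \<noteq> {}" and f: "\<And>p. p \<in> P \<Longrightarrow> f p \<in> carrier_mat D D" and g: "g \<in> carrier_mat D D"
    and fg: "\<And>p. p \<in> P \<Longrightarrow> hs_prod (f p) g = of_real c" and gg: "hs_prod g g = of_real c"
  defines "A \<equiv> mat D D (\<lambda>(I, J). (\<Sum>p\<in>P. f p $$ (I, J)) / of_nat (card P) - g $$ (I, J))"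
  shows "hs_prod A A = (\<Sum>p\<in>P. \<Sum>q\<in>P. hs_prod (f p) (f q)) / (of_nat (card P))\<^sup>2 - of_real c"
proof -
  define N where "N = (of_nat (card P) :: complex)"
  have N: "N \<noteq> 0" "cnj N = N" using P by (auto simp: N_def)
  let ?s = "\<lambda>F. \<Sum>I<D. \<Sum>J<D. F I J"
  have gf: "hs_prod g (f p) = of_real c" if "p \<in> P" for p
  proof -
    have "hs_prod g (f p) = cnj (hs_prod (f p) g)"
      by (simp add: hs_prod_carrier[OF f[OF that]] hs_prod_carrier[OF g] mult.commute)
    thus ?thesis using fg[OF that] by simp
  qed
  have "hs_prod A A = ?s (\<lambda>I J. ((\<Sum>p\<in>P. f p $$ (I, J)) / N - g $$ (I, J)) *
       cnj ((\<Sum>p\<in>P. f p $$ (I, J)) / N - g $$ (I, J)))"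
    by (simp add: hs_prod_def A_def N_def)
  also have "\<dots> = ?s (\<lambda>I J. (\<Sum>p\<in>P. \<Sum>q\<in>P. f p $$ (I, J) * cnj (f q $$ (I, J))) / N\<^sup>2
      - (\<Sum>p\<in>P. f p $$ (I, J) * cnj (g $$ (I, J))) / N - (\<Sum>p\<in>P. g $$ (I, J) * cnj (f p $$ (I, J))) / N
      + g $$ (I, J) * cnj (g $$ (I, J)))"
    by (intro sum.cong refl)
      (simp add: N field_simps power2_eq_square flip: sum_product sum_distrib_left sum_distrib_right)
  also have "\<dots> = ?s (\<lambda>I J. \<Sum>p\<in>P. \<Sum>q\<in>P. f p $$ (I, J) * cnj (f q $$ (I, J))) / N\<^sup>2
      - ?s (\<lambda>I J. \<Sum>p\<in>P. f p $$ (I, J) * cnj (g $$ (I, J))) / N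
      - ?s (\<lambda>I J. \<Sum>p\<in>P. g $$ (I, J) * cnj (f p $$ (I, J))) / N
      + ?s (\<lambda>I J. g $$ (I, J) * cnj (g $$ (I, J)))"
    by (simp only: sum.distrib sum_subtractf sum_divide_distrib)
  also have "?s (\<lambda>I J. \<Sum>p\<in>P. \<Sum>q\<in>P. f p $$ (I, J) * cnj (f q $$ (I, J)))
      = (\<Sum>p\<in>P. \<Sum>q\<in>P. hs_prod (f p) (f q))"
  proof -
    have "(\<Sum>p\<in>P. \<Sum>q\<in>P. hs_prod (f p) (f q)) = (\<Sum>p\<in>P. \<Sum>q\<in>P. ?s (\<lambda>I J. f p $$ (I, J) * cnj (f q $$ (I, J))))"
      by (intro sum.cong refl hs_prod_carrier f)
    also have "\<dots> = ?s (\<lambda>I J. \<Sum>p\<in>P. \<Sum>q\<in>P. f p $$ (I, J) * cnj (f q $$ (I, J)))"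
      by (simp only: sum.swap[of _ "{..<D}" P])
    finally show ?thesis ..
  qed
  also have "?s (\<lambda>I J. \<Sum>p\<in>P. f p $$ (I, J) * cnj (g $$ (I, J))) = (\<Sum>p\<in>P. hs_prod (f p) g)"
  proof -
    have "(\<Sum>p\<in>P. hs_prod (f p) g) = (\<Sum>p\<in>P. ?s (\<lambda>I J. f p $$ (I, J) * cnj (g $$ (I, J))))"
      by (intro sum.cong refl hs_prod_carrier f)
    thus ?thesis by (simp only: sum.swap[of _ "{..<D}" P])
  qed
  also have "?s (\<lambda>I J. \<Sum>p\<in>P. g $$ (I, J) * cnj (f p $$ (I, J))) = (\<Sum>p\<in>P. hs_prod g (f p))"
  proof -
    have "(\<Sum>p\<in>P. hs_prod g (f p)) = (\<Sum>p\<in>P. ?s (\<lambda>I J. g $$ (I, J) * cnj (f p $$ (I, J))))"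
      by (intro sum.cong refl hs_prod_carrier g)
    thus ?thesis by (simp only: sum.swap[of _ "{..<D}" P])
  qed
  also have "?s (\<lambda>I J. g $$ (I, J) * cnj (g $$ (I, J))) = hs_prod g g"
    by (rule hs_prod_carrier[OF g, symmetric])
  also have "(\<Sum>p\<in>P. hs_prod (f p) g) = N * of_real c" using fg by (simp add: N_def)
  also have "(\<Sum>p\<in>P. hs_prod g (f p)) = N * of_real c" using gf by (simp add: N_def)
  finally show ?thesis using N gg by (simp add: N_def)
qed

lemma output_prob_sum:
  assumes "binary_measurement (d ^ m) M" "\<rho> \<in> carrier_mat d d"
  shows "output_prob M m \<rho> False + output_prob M m \<rho> True = Re (mtrace \<rho> ^ m)"
proof -
  let ?T = "tensor_pow \<rho> m" and ?D = "d ^ m"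
  have c: "M b \<in> carrier_mat ?D ?D" for b
    using assms unfolding binary_measurement_def pos_semidef_def by blast
  have T: "?T \<in> carrier_mat ?D ?D" using tensor_pow_carrier[OF assms(2)] .
  have "mtrace (M False * ?T) + mtrace (M True * ?T) = mtrace ((M False + M True) * ?T)"
    using c[of True] T unfolding mtrace_mult[OF c T] mtrace_mult[OF add_carrier_mat[OF c] T]
    by (simp add: algebra_simps sum.distrib)
  also have "\<dots> = mtrace \<rho> ^ m"
    using assms T mtrace_tensor_pow[OF assms(2)] by (simp add: binary_measurement_def)
  finally show ?thesis by (metis output_prob_def plus_complex.sel(1))
qed

text \<open>The acceptance probability, averaged over the family \<open>\<rho>\<close>, differs from that of \<open>\<sigma>\<close> by at least
  \<open>1/3\<close>; by Cauchy--Schwarz on the common support of dimension \<open>r ^ m\<close>, the Hilbert--Schmidt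
  distance of the averaged states is at least \<open>1 / (3 r ^ (m / 2))\<close>.\<close>

lemma second_moment_lower_bound:
  fixes \<rho> :: "'a \<Rightarrow> complex mat" and d r m :: nat and h :: "'a \<Rightarrow> 'a \<Rightarrow> real" and c :: real
  assumes M: "binary_measurement (d ^ m) M" and rd: "r \<le> d" and P: "finite P" "P \<noteq> {}"
    and \<rho>: "\<And>p. p \<in> P \<Longrightarrow> \<rho> p \<in> carrier_mat d d" and \<sigma>: "\<sigma> \<in> carrier_mat d d" "mtrace \<sigma> = 1"
    and \<rho>0: "\<And>p i j. p \<in> P \<Longrightarrow> i < d \<Longrightarrow> j < d \<Longrightarrow> r \<le> i \<or> r \<le> j \<Longrightarrow> \<rho> p $$ (i, j) = 0"
    and \<sigma>0: "\<And>i j. i < d \<Longrightarrow> j < d \<Longrightarrow> r \<le> i \<or> r \<le> j \<Longrightarrow> \<sigma> $$ (i, j) = 0"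
    and hs: "\<And>p q. p \<in> P \<Longrightarrow> q \<in> P \<Longrightarrow> hs_prod (\<rho> p) (\<rho> q) = of_real (h p q)"
      "\<And>p. p \<in> P \<Longrightarrow> hs_prod (\<rho> p) \<sigma> = of_real c" "hs_prod \<sigma> \<sigma> = of_real c"
    and yes: "\<And>p. p \<in> P \<Longrightarrow> output_prob M m (\<rho> p) True \<ge> 2 / 3"
    and no: "output_prob M m \<sigma> False \<ge> 2 / 3"
  shows "1 / 9 \<le> real r ^ m * ((\<Sum>p\<in>P. \<Sum>q\<in>P. h p q ^ m) / (real (card P))\<^sup>2 - c ^ m)"
proof -
  let ?D = "d ^ m" and ?N = "card P" and ?S = "small_digits d r m"
  have N: "?N > 0" using P by (simp add: card_gt_0_iff)
  have psd: "pos_semidef ?D (M True)" "pos_semidef ?D (M False)" "M False + M True = 1\<^sub>m ?D"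
    using M unfolding binary_measurement_def by auto
  have c: "M True \<in> carrier_mat ?D ?D" using psd unfolding pos_semidef_def by blast
  have T: "tensor_pow (\<rho> p) m \<in> carrier_mat ?D ?D" if "p \<in> P" for p
    using tensor_pow_carrier[OF \<rho>[OF that]] .
  have T\<sigma>: "tensor_pow \<sigma> m \<in> carrier_mat ?D ?D" using tensor_pow_carrier[OF \<sigma>(1)] .
  define A where "A = mat ?D ?D (\<lambda>(I, J).
      (\<Sum>p\<in>P. tensor_pow (\<rho> p) m $$ (I, J)) / of_nat ?N - tensor_pow \<sigma> m $$ (I, J))"
  have A: "A \<in> carrier_mat ?D ?D" by (simp add: A_def)
  have "mtrace (M True * A) = (\<Sum>I<?D. \<Sum>J<?D. (\<Sum>p\<in>P. M True $$ (I, J) * tensor_pow (\<rho> p) m $$ (J, I)) / of_nat ?N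
      - M True $$ (I, J) * tensor_pow \<sigma> m $$ (J, I))"
    unfolding mtrace_mult[OF c A]
    by (intro sum.cong refl) (simp add: A_def algebra_simps sum_distrib_left)
  also have "\<dots> = (\<Sum>I<?D. \<Sum>J<?D. \<Sum>p\<in>P. M True $$ (I, J) * tensor_pow (\<rho> p) m $$ (J, I)) / of_nat ?N
      - mtrace (M True * tensor_pow \<sigma> m)"
    unfolding mtrace_mult[OF c T\<sigma>] by (simp only: sum_subtractf sum_divide_distrib)
  also have "(\<Sum>I<?D. \<Sum>J<?D. \<Sum>p\<in>P. M True $$ (I, J) * tensor_pow (\<rho> p) m $$ (J, I))
      = (\<Sum>p\<in>P. \<Sum>I<?D. \<Sum>J<?D. M True $$ (I, J) * tensor_pow (\<rho> p) m $$ (J, I))"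
    by (simp only: sum.swap[of _ P "{..<?D}"])
  also have "\<dots> = (\<Sum>p\<in>P. mtrace (M True * tensor_pow (\<rho> p) m))"
    by (intro sum.cong refl mtrace_mult[symmetric] c T)
  finally have "Re (mtrace (M True * A)) = (\<Sum>p\<in>P. output_prob M m (\<rho> p) True) / ?N - output_prob M m \<sigma> True"
    by (simp add: output_prob_def)
  moreover have "2 / 3 \<le> (\<Sum>p\<in>P. output_prob M m (\<rho> p) True) / ?N"
  proof -
    have "(\<Sum>p\<in>P. 2 / 3) \<le> (\<Sum>p\<in>P. output_prob M m (\<rho> p) True)" by (intro sum_mono yes)
    thus ?thesis using N by (simp add: field_simps)
  qed
  moreover have "output_prob M m \<sigma> True \<le> 1 / 3"
    using output_prob_sum[OF M \<sigma>(1)] \<sigma>(2) no by simp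
  ultimately have gap: "1 / 3 \<le> Re (mtrace (M True * A))" by simp
  have "Re (mtrace (M True * A)) \<le> sqrt (card ?S) * sqrt (Re (hs_prod A A))"
  proof (rule effect_trace_le[OF psd])
    show "?S \<subseteq> {..<?D}" using small_digits_less[OF rd] by auto
    show "A $$ (I, J) = 0" if "I < ?D" "J < ?D" "I \<notin> ?S \<or> J \<notin> ?S" for I J
      using that tensor_pow_zero[OF \<rho> \<rho>0 that] tensor_pow_zero[OF \<sigma>(1) \<sigma>0 that] by (simp add: A_def)
  qed (rule A)
  with gap have "1 / 3 \<le> sqrt (card ?S * Re (hs_prod A A))" by (simp add: real_sqrt_mult)
  hence "(1 / 3)\<^sup>2 \<le> card ?S * Re (hs_prod A A)"
    by (metis power2_eq_square real_sqrt_le_iff real_sqrt_abs2 abs_of_pos zero_less_divide_1_iff zero_less_numeral)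
  hence "1 / 9 \<le> card ?S * Re (hs_prod A A)" by (simp add: power2_eq_square)
  also have "\<dots> \<le> real r ^ m * Re (hs_prod A A)"
  proof (intro mult_right_mono)
    show "real (card ?S) \<le> real r ^ m"
      using card_small_digits[of d r m] by (metis of_nat_le_iff of_nat_power)
    have "Re (hs_prod A A) = (\<Sum>I<?D. \<Sum>J<?D. (cmod (A $$ (I, J)))\<^sup>2)"
      by (simp only: cmod_power2) (simp add: hs_prod_carrier[OF A] power2_eq_square)
    thus "0 \<le> Re (hs_prod A A)" by (simp add: sum_nonneg)
  qed
  also have "hs_prod A A = (\<Sum>p\<in>P. \<Sum>q\<in>P. hs_prod (tensor_pow (\<rho> p) m) (tensor_pow (\<rho> q) m)) / (of_nat ?N)\<^sup>2
      - of_real (c ^ m)"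
    unfolding A_def using hs
    by (intro hs_prod_average_diff P T T\<sigma>) (auto simp: hs_prod_tensor_pow[OF \<rho> \<sigma>(1)] hs_prod_tensor_pow[OF \<sigma>(1) \<sigma>(1)])
  also have "(\<Sum>p\<in>P. \<Sum>q\<in>P. hs_prod (tensor_pow (\<rho> p) m) (tensor_pow (\<rho> q) m)) = (\<Sum>p\<in>P. \<Sum>q\<in>P. of_real (h p q ^ m))"
    by (intro sum.cong refl) (simp add: hs_prod_tensor_pow[OF \<rho> \<rho>] hs)
  also have "(\<Sum>p\<in>P. \<Sum>q\<in>P. of_real (h p q ^ m)) / (of_nat ?N)\<^sup>2 - of_real (c ^ m)
      = (of_real ((\<Sum>p\<in>P. \<Sum>q\<in>P. h p q ^ m) / (real ?N)\<^sup>2 - c ^ m) :: complex)"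
    by simp
  finally show ?thesis by (simp only: Re_complex_of_real)
qed

section \<open>The lower bound\<close>

lemma hs_prod_perturbed:
  fixes a b b' :: real
  assumes "pairing d r K \<tau>" "pairing d r K \<tau>'"
  shows "hs_prod (perturbed d r K \<tau> a b) (perturbed d r K \<tau>' a b')
    = of_real (r * a\<^sup>2 + b * b' * card {i \<in> {..<K}. \<tau> i = \<tau>' i})"
proof -
  interpret \<tau>: pairing d r K \<tau> by fact
  interpret \<tau>': pairing d r K \<tau>' by fact
  let ?e = "\<lambda>\<tau> b i j. (if i < r \<and> i = j then a else 0) + (if i < K \<and> j = \<tau> i then b else 0)"
  have row: "(\<Sum>j<d. ?e \<tau> b i j * ?e \<tau>' b' i j)
      = (if i < r then a\<^sup>2 else 0) + (if i < K \<and> \<tau> i = \<tau>' i then b * b' else 0)" if "i < d" for i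
  proof -
    have "(\<Sum>j<d. ?e \<tau> b i j * ?e \<tau>' b' i j) = (\<Sum>j<d. (if j = i then if i < r then a\<^sup>2 else 0 else 0)
        + (if j = \<tau> i then if i < K \<and> \<tau> i = \<tau>' i then b * b' else 0 else 0))"
      using \<tau>.nofix[of i] \<tau>'.nofix[of i] by (intro sum.cong) (auto simp: power2_eq_square)
    also have "\<dots> = (if i < r then a\<^sup>2 else 0) + (if i < K \<and> \<tau> i = \<tau>' i then b * b' else 0)"
      unfolding sum.distrib using that \<tau>.lt[of i] \<tau>.Kr \<tau>.rd by (auto simp: sum.delta)
    finally show ?thesis .
  qed
  have "hs_prod (perturbed d r K \<tau> a b) (perturbed d r K \<tau>' a b')
      = (\<Sum>i<d. \<Sum>j<d. of_real (?e \<tau> b i j * ?e \<tau>' b' i j))"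
    unfolding hs_prod_carrier[OF perturbed_carrier]
    by (intro sum.cong refl) (simp add: perturbed_def)
  also have "\<dots> = of_real (\<Sum>i<d. \<Sum>j<d. ?e \<tau> b i j * ?e \<tau>' b' i j)" by simp
  also have "(\<Sum>i<d. \<Sum>j<d. ?e \<tau> b i j * ?e \<tau>' b' i j)
      = (\<Sum>i<d. if i < r then a\<^sup>2 else 0) + (\<Sum>i<d. if i < K \<and> \<tau> i = \<tau>' i then b * b' else 0)"
    unfolding sum.distrib[symmetric] by (intro sum.cong refl row) simp
  also have "(\<Sum>i<d. if i < r then a\<^sup>2 else 0) = (\<Sum>i<r. a\<^sup>2)"
    using \<tau>.rd by (intro sum.mono_neutral_cong_right) auto
  also have "(\<Sum>i<d. if i < K \<and> \<tau> i = \<tau>' i then b * b' else 0) = (\<Sum>i\<in>{i \<in> {..<K}. \<tau> i = \<tau>' i}. b * b')"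
    using \<tau>.rd \<tau>.Kr by (intro sum.mono_neutral_cong_right) auto
  finally show ?thesis by (simp add: mult_ac)
qed

definition block_swap :: "nat \<Rightarrow> (nat \<Rightarrow> nat) \<Rightarrow> nat \<Rightarrow> nat" where
  "block_swap k p i = (if i < k then k + p i else inv_into UNIV p (i - k))"

lemma pairing_block_swap:
  assumes "p permutes {..<k}" "2 * k \<le> r" "r \<le> d"
  shows "pairing d r (2 * k) (block_swap k p)"
proof
  have p: "p i < k" "inv_into UNIV p i < k" if "i < k" for i
    using that permutes_in_image[OF assms(1)] permutes_in_image[OF permutes_inv[OF assms(1)]] by auto
  fix i assume i: "i < 2 * k"
  hence i': "i - k < k" by auto
  show "block_swap k p i < 2 * k" "block_swap k p (block_swap k p i) = i" "block_swap k p i \<noteq> i"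
    using i p[of i] p[OF i'] permutes_inverses[OF assms(1)]
    by (auto simp: block_swap_def)
qed (use assms in auto)

lemma card_block_swap_agree:
  assumes p: "p permutes {..<k}" and q: "q permutes {..<k}"
  shows "card {i \<in> {..<2 * k}. block_swap k p i = block_swap k q i} = 2 * card {i \<in> {..<k}. p i = q i}"
proof -
  let ?G = "{i \<in> {..<k}. p i = q i}"
  have split: "{i \<in> {..<2 * k}. block_swap k p i = block_swap k q i} = ?G \<union> (\<lambda>i. k + p i) ` ?G"
  proof (intro equalityI subsetI)
    fix i assume i: "i \<in> {i \<in> {..<2 * k}. block_swap k p i = block_swap k q i}"
    show "i \<in> ?G \<union> (\<lambda>i. k + p i) ` ?G"
    proof (cases "i < k")
      case False
      define j where "j = inv_into UNIV p (i - k)"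
      have ik: "i - k < k" "inv_into UNIV q (i - k) = j" using i False by (auto simp: block_swap_def j_def)
      have "p j = i - k" unfolding j_def by (rule permutes_inverses(1)[OF p])
      moreover have "q j = i - k" unfolding ik(2)[symmetric] by (rule permutes_inverses(1)[OF q])
      moreover have "j < k" unfolding j_def using permutes_in_image[OF permutes_inv[OF p]] ik(1) by blast
      ultimately show ?thesis using False by (intro UnI2 image_eqI[of _ _ j]) simp_all
    qed (use i in \<open>auto simp: block_swap_def\<close>)
  next
    fix i assume "i \<in> ?G \<union> (\<lambda>i. k + p i) ` ?G"
    thus "i \<in> {i \<in> {..<2 * k}. block_swap k p i = block_swap k q i}"
    proof
      assume "i \<in> (\<lambda>i. k + p i) ` ?G"
      then obtain j where j: "i = k + p j" "j < k" "p j = q j" by auto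
      have "p j < k" using permutes_in_image[OF p, of j] j(2) by simp
      moreover have "inv_into UNIV p (p j) = j" by (rule permutes_inverses(2)[OF p])
      moreover have "inv_into UNIV q (p j) = j" unfolding j(3) by (rule permutes_inverses(2)[OF q])
      ultimately show ?thesis using j(1) by (simp add: block_swap_def)
    qed (auto simp: block_swap_def)
  qed
  have "inj (\<lambda>i. k + p i)"
    using permutes_inj[OF p] by (simp add: inj_def)
  hence "card ((\<lambda>i. k + p i) ` ?G) = card ?G"
    by (intro card_image) (rule inj_on_subset[OF _ subset_UNIV])
  moreover have "?G \<inter> (\<lambda>i. k + p i) ` ?G = {}" by fastforce
  ultimately show ?thesis unfolding split by (subst card_Un_disjoint) simp_all
qed

lemma exp_exp_small:
  fixes y :: real
  assumes "10 / 9 \<le> exp (exp y - 1)" "0 \<le> y"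
  shows "1 / 20 \<le> y"
proof (rule ccontr)
  assume y: "\<not> 1 / 20 \<le> y"
  have "y\<^sup>2 \<le> (1 / 20)\<^sup>2" using y assms by (intro power_mono) auto
  hence "exp y - 1 \<le> 53 / 1000" using exp_bound[of y] y assms by (simp add: power2_eq_square)
  moreover have "0 \<le> exp y - 1" using assms by simp
  moreover from calculation have "(exp y - 1)\<^sup>2 \<le> (53 / 1000)\<^sup>2" by (intro power_mono)
  ultimately show False
    using exp_bound[of "exp y - 1"] assms by (simp add: power2_eq_square)
qed

theorem theorem6p8:
  shows "\<exists>c::real. c > 0 \<and>
    (\<forall>(n::nat) (r::nat) (\<alpha>::real) (\<epsilon>::real).
       1 \<le> n \<and> 2 \<le> r \<and> r \<le> 2 ^ n \<and> 1 \<le> \<alpha> \<and> \<alpha> \<le> 1 + 1 / real n \<and> 0 < \<epsilon> \<and> \<epsilon> \<le> 1 / 4 \<longrightarrow>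
       (\<forall>(m::nat) (M :: bool \<Rightarrow> complex mat).
          decides_uniformity n r \<alpha> \<epsilon> m M \<longrightarrow> real m \<ge> c * (real r / \<epsilon>\<^sup>2)))"
proof (intro exI[of _ "1 / 640"] conjI allI impI; (elim conjE)?)
  fix n r m :: nat and \<alpha> \<epsilon> :: real and M :: "bool \<Rightarrow> complex mat"
  assume n: "1 \<le> n" and r: "2 \<le> r" "r \<le> 2 ^ n" and \<alpha>: "1 \<le> \<alpha>" "\<alpha> \<le> 1 + 1 / real n"
    and \<epsilon>: "0 < \<epsilon>" "\<epsilon> \<le> 1 / 4" and M: "decides_uniformity n r \<alpha> \<epsilon> m M"
  define d :: nat where "d = 2 ^ n"
  define k where "k = r div 2"
  define R where "R = real (2 * k) powr (1 / \<alpha>)"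
  define b where "b = 2 * \<epsilon> / R" \<comment> \<open>puts the perturbed states at distance exactly \<open>\<epsilon>\<close>\<close>
  have k: "1 \<le> k" "2 * k \<le> r" using r by (auto simp: k_def)
  have rd: "r \<le> d" using r by (simp add: d_def)
  have R: "r < 2 * R" "0 < R"
    using rank_lt_twice_root[OF n r \<alpha>] k by (auto simp: R_def k_def[symmetric])
  have "2 * \<epsilon> * r < 4 * \<epsilon> * R" using \<epsilon> R by simp
  also have "\<dots> \<le> R" using \<epsilon> R by simp
  finally have b: "0 < b" "b < 1 / real r" using \<epsilon> R r by (auto simp: b_def field_simps)
  let ?\<rho> = "\<lambda>p. perturbed d r (2 * k) (block_swap k p) (1 / real r) b"
  let ?\<sigma> = "perturbed d r (2 * k) (block_swap k id) (1 / real r) 0"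
  let ?P = "{p. p permutes {..<k}}"
  let ?F = "\<lambda>p q. card {i \<in> {..<k}. p i = q i}"
  have sw: "pairing d r (2 * k) (block_swap k p)" if "p \<in> ?P" for p
    using pairing_block_swap k rd that by blast
  have id: "id \<in> ?P" by (simp add: permutes_id)
  have state: "qubit_state n (perturbed d r (2 * k) (block_swap k p) (1 / real r) b')"
      "mrank (perturbed d r (2 * k) (block_swap k p) (1 / real r) b') = r"
      "T_dist \<alpha> (perturbed d r (2 * k) (block_swap k p) (1 / real r) b')
        (uniform_state (perturbed d r (2 * k) (block_swap k p) (1 / real r) b')) = R * b' / 2"
    if p: "p \<in> ?P" and b': "0 \<le> b'" "b' < 1 / real r" for p b'
  proof -
    interpret pairing d r "2 * k" "block_swap k p" by (rule sw[OF p])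
    show "qubit_state n (perturbed d r (2 * k) (block_swap k p) (1 / real r) b')"
      using pos_semidef_perturbed[of b' "1 / real r"] b' mtrace_perturbed[of "1 / real r" b'] r
      by (simp add: qubit_state_def d_def[symmetric])
    show "mrank (perturbed d r (2 * k) (block_swap k p) (1 / real r) b') = r"
      by (rule mrank_perturbed[OF sw[OF p] b'])
    have "(real (2 * k) * b' powr \<alpha>) powr (1 / \<alpha>) = R * b'"
      using b' \<alpha> by (simp add: R_def powr_mult powr_powr)
    thus "T_dist \<alpha> (perturbed d r (2 * k) (block_swap k p) (1 / real r) b')
        (uniform_state (perturbed d r (2 * k) (block_swap k p) (1 / real r) b')) = R * b' / 2"
      unfolding uniform_state_perturbed[OF b'] T_dist_perturbed[OF b'(1)] by simp
  qed
  have "1 / 9 \<le> real r ^ m *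
      ((\<Sum>p\<in>?P. \<Sum>q\<in>?P. ((1 + 2 * (real r * b\<^sup>2) * real (?F p q)) / real r) ^ m)
        / (real (card ?P))\<^sup>2 - (1 / real r) ^ m)"
  proof (rule second_moment_lower_bound[of d m M r ?P ?\<rho> ?\<sigma>])
    show "binary_measurement (d ^ m) M" using M by (simp add: decides_uniformity_def d_def)
    show "?P \<noteq> {}" using id by blast
    show "mtrace ?\<sigma> = 1"
      using pairing.mtrace_perturbed[OF sw[OF id]] r by simp
    show "?\<rho> p $$ (i, j) = 0" if "p \<in> ?P" "i < d" "j < d" "r \<le> i \<or> r \<le> j" for p i j
      using that pairing.pairing_sym[OF sw[OF that(1)], of i j] k by (auto simp: perturbed_def)
    show "hs_prod (?\<rho> p) (?\<rho> q) = of_real ((1 + 2 * (real r * b\<^sup>2) * real (?F p q)) / real r)" if "p \<in> ?P" "q \<in> ?P" for p q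
      unfolding hs_prod_perturbed[OF sw[OF that(1)] sw[OF that(2)]]
      using card_block_swap_agree[of p k q] that r by (simp add: field_simps power2_eq_square)
    show "hs_prod (?\<rho> p) ?\<sigma> = of_real (1 / real r)" if "p \<in> ?P" for p
      unfolding hs_prod_perturbed[OF sw[OF that] sw[OF id]] using r by (simp add: power2_eq_square)
    show "hs_prod ?\<sigma> ?\<sigma> = of_real (1 / real r)"
      unfolding hs_prod_perturbed[OF sw[OF id] sw[OF id]] using r by (simp add: power2_eq_square)
    show "output_prob M m (?\<rho> p) True \<ge> 2 / 3" if "p \<in> ?P" for p
      using M state[OF that, of b] b R unfolding decides_uniformity_def by (auto simp: b_def)
    show "output_prob M m ?\<sigma> False \<ge> 2 / 3"
      using M state[OF id, of 0] r unfolding decides_uniformity_def by auto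
  qed (use rd in \<open>auto simp: finite_permutations perturbed_no_swap mat_diag_def\<close>)
  also have "\<dots> = (\<Sum>p\<in>?P. \<Sum>q\<in>?P. (1 + 2 * (real r * b\<^sup>2) * real (?F p q)) ^ m) / (fact k)\<^sup>2 - 1"
    using r by (simp add: card_permutations power_divide right_diff_distrib flip: sum_divide_distrib)
  finally have low: "10 / 9 \<le> (\<Sum>p\<in>?P. \<Sum>q\<in>?P. (1 + 2 * (real r * b\<^sup>2) * real (?F p q)) ^ m) / (fact k)\<^sup>2" by simp
  define y where "y = 2 * (real r * b\<^sup>2) * m"
  have y: "0 \<le> y" by (simp add: y_def)
  have "(1 + 2 * (real r * b\<^sup>2) * real (?F p q)) ^ m \<le> exp y ^ ?F p q" for p q
  proof -
    have "(1 + 2 * (real r * b\<^sup>2) * real (?F p q)) ^ m \<le> exp (2 * (real r * b\<^sup>2) * real (?F p q)) ^ m"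
      by (intro power_mono) auto
    thus ?thesis by (simp add: y_def mult_ac flip: exp_of_nat_mult)
  qed
  hence "(\<Sum>p\<in>?P. \<Sum>q\<in>?P. (1 + 2 * (real r * b\<^sup>2) * real (?F p q)) ^ m) \<le> (\<Sum>p\<in>?P. \<Sum>q\<in>?P. exp y ^ ?F p q)"
    by (intro sum_mono)
  also have "\<dots> \<le> (fact k)\<^sup>2 * exp (exp y - 1)"
    using sum_power_agreements_le[of "{..<k}" "exp y"] y by simp
  finally have "(\<Sum>p\<in>?P. \<Sum>q\<in>?P. (1 + 2 * (real r * b\<^sup>2) * real (?F p q)) ^ m) / (fact k)\<^sup>2 \<le> exp (exp y - 1)"
    by (simp add: field_simps)
  with low have "1 / 20 \<le> y" using exp_exp_small[OF _ y] by linarith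
  hence "1 / 40 \<le> r * b\<^sup>2 * m" by (simp add: y_def)
  also have "\<dots> \<le> r * (4 * \<epsilon> / r)\<^sup>2 * m"
    using b r R \<epsilon> by (intro mult_right_mono mult_left_mono power_mono) (auto simp: b_def field_simps)
  also have "\<dots> = 16 * \<epsilon>\<^sup>2 * m / r" using r by (simp add: power2_eq_square field_simps)
  finally show "1 / 640 * (real r / \<epsilon>\<^sup>2) \<le> real m"
    using r \<epsilon> by (simp add: field_simps)
qed simp

end
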